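(* For each integer $n\ge2$ and each real $\epsilon$ with $0<\epsilon<\frac{e_n}{4}$, the set $$K_{n,\epsilon}=\Big(R_2\setminus\bigcup_{l=0}^\infty E_l\Big)\cup\Big(\bigcup_{l=0}^\infty F_l\Big)\cup(S_1\cup S_2\cup S_3)\cup\Big(L_2\setminus\bigcup_{l=0}^\infty G_l\Big)\cup\Big(\bigcup_{l=0}^\infty H_l\Big)\cup(T_1\cup T_2\cup T_3)$$ is a bounded symmetric wavelet set of $L^2(\mathbb R)$ having $0$ as an accumulation point.
   Context: Fourier transform: $\widehat\psi(\xi)=\int_{\mathbb R}\psi(x)e^{-2\pi i x\xi}\,dx$. An orthonormal wavelet is a function $\psi\in L^2(\mathbb R)$ such that $\{2^{j/2}\psi(2^jx-k): j,k\in\mathbb Z\}$ is an orthonormal basis of $L^2(\mathbb R)$. A measurable set $K\subset\mathbb R$ is a wavelet set (of $L^2(\mathbb R)$) if there is an orthonormal wavelet $\psi$ with $|\widehat\psi|=\chi_K$ a.e. It is symmetric if $K\cap(-\infty,0]=-(K\cap[0,\infty))$. For $n\ge2$ put $$a_n=\frac{2^{n-2}}{2^n-1},\quad d_n=\frac{2^{2n-2}}{2^n-1},\quad e_n=\frac{2^{n-1}-1}{2^n-1},\quad L_2=[-d_n,-2^{n-2}],\quad R_2=[2^{n-2},d_n].$$ For $0<\epsilon<\frac{e_n}4$ put $$S_1=\left[\frac{a_n}2+\frac{\epsilon}{2^n},\frac{a_n}2+\epsilon\right],\quad S_2=\left[a_n+2\epsilon,\tfrac12\right],\quad S_3=[d_n,d_n+2\epsilon],\quad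 T_i=-S_i\ (i=1,2,3),$$ and define recursively $$E_0=S_1+2^{n-2},\quad F_0=\frac1{2^{n+1}}E_0,\qquad E_l=F_{l-1}+2^{n-2},\quad F_l=\frac1{2^{n+l+1}}E_l\quad(l\ge1),$$ $$G_l=-E_l,\quad H_l=-F_l\quad(l\ge0).$$ Here $S+t$ and $tS$ denote the translate and the dilate of a set $S$ by a real $t$. *)

theory Defs
  imports "HOL-Analysis.Analysis"
begin

text \<open>Elements of $L^2$ are represented by functions; equality of classes is equality a.e.\<close>

definition L2_fun :: "(real \<Rightarrow> complex) set" where
  "L2_fun = {f \<in> borel_measurable lebesgue. integrable lebesgue (\<lambda>x. (cmod (f x))\<^sup>2)}"

definition L2_inner :: "(real \<Rightarrow> complex) \<Rightarrow> (real \<Rightarrow> complex) \<Rightarrow> complex" where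
  "L2_inner f g = (LINT x|lebesgue. f x * cnj (g x))"

text \<open>The squared $L^2$ distance is a nonnegative extended integral, so that it is infinite
  (and not $0$) when the difference is not square-integrable.\<close>

definition L2_dist_sq :: "(real \<Rightarrow> complex) \<Rightarrow> (real \<Rightarrow> complex) \<Rightarrow> ennreal" where
  "L2_dist_sq f g = (\<integral>\<^sup>+ x. ennreal ((cmod (f x - g x))\<^sup>2) \<partial>lebesgue)"

definition L2_orthonormal_basis :: "'i set \<Rightarrow> ('i \<Rightarrow> real \<Rightarrow> complex) \<Rightarrow> bool" where
  "L2_orthonormal_basis I u \<longleftrightarrow>
     (\<forall>i\<in>I. u i \<in> L2_fun) \<and>
     (\<forall>i\<in>I. \<forall>j\<in>I. L2_inner (u i) (u j) = (if i = j then 1 else 0)) \<and>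
     (\<forall>f\<in>L2_fun. \<forall>\<delta>>0. \<exists>J c. finite J \<and> J \<subseteq> I \<and> L2_dist_sq f (\<lambda>x. \<Sum>i\<in>J. c i * u i x) < \<delta>)"

definition fourier_integral :: "(real \<Rightarrow> complex) \<Rightarrow> real \<Rightarrow> complex" where
  "fourier_integral f \<xi> = (LINT x|lebesgue. f x * exp (- (2 * of_real pi * \<i> * of_real x * of_real \<xi>)))"

text \<open>A square-integrable \<open>f\<close> need not be integrable, so its transform is the $L^2$ limit of the
  transforms of its truncations to $[-N,N]$. It is determined only a.e., hence a relation.\<close>

definition has_L2_fourier_transform ::
  "(real \<Rightarrow> complex) \<Rightarrow> (real \<Rightarrow> complex) \<Rightarrow> bool" (infix "has'_L2'_fourier'_transform" 50) where
  "f has_L2_fourier_transform g \<longleftrightarrow> f \<in> L2_fun \<and> g \<in> L2_fun \<and>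
     (\<lambda>N::nat. L2_dist_sq (fourier_integral (\<lambda>x. indicator {- real N..real N} x * f x)) g)
       \<longlonglongrightarrow> 0"

definition wavelet_system :: "(real \<Rightarrow> complex) \<Rightarrow> int \<times> int \<Rightarrow> real \<Rightarrow> complex" where
  "wavelet_system \<psi> = (\<lambda>(j, k) x.
     of_real (2 powr (of_int j / 2)) * \<psi> (2 powi j * x - of_int k))"

definition orthonormal_wavelet :: "(real \<Rightarrow> complex) \<Rightarrow> bool" where
  "orthonormal_wavelet \<psi> \<longleftrightarrow> \<psi> \<in> L2_fun \<and> L2_orthonormal_basis UNIV (wavelet_system \<psi>)"

definition wavelet_set :: "real set \<Rightarrow> bool" where
  "wavelet_set K \<longleftrightarrow> K \<in> sets lebesgue \<and>
     (\<exists>\<psi> \<psi>hat. orthonormal_wavelet \<psi> \<and> \<psi> has_L2_fourier_transform \<psi>hat \<and>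
        (AE \<xi> in lebesgue. cmod (\<psi>hat \<xi>) = indicator K \<xi>))"

definition symmetric_set :: "real set \<Rightarrow> bool" where
  "symmetric_set K \<longleftrightarrow> K \<inter> {..0} = uminus ` (K \<inter> {0..})"

text \<open>The exponents use truncated subtraction on naturals, so the formulas are meant for
  \<open>n \<ge> 2\<close> only.\<close>

definition a_par :: "nat \<Rightarrow> real" where
  "a_par n = 2 ^ (n - 2) / (2 ^ n - 1)"

definition d_par :: "nat \<Rightarrow> real" where
  "d_par n = 2 ^ (2 * n - 2) / (2 ^ n - 1)"

definition e_par :: "nat \<Rightarrow> real" where
  "e_par n = (2 ^ (n - 1) - 1) / (2 ^ n - 1)"

definition L2_ivl :: "nat \<Rightarrow> real set" where
  "L2_ivl n = {- d_par n .. - (2 ^ (n - 2))}"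

definition R2_ivl :: "nat \<Rightarrow> real set" where
  "R2_ivl n = {2 ^ (n - 2) .. d_par n}"

definition S1_set :: "nat \<Rightarrow> real \<Rightarrow> real set" where
  "S1_set n \<epsilon> = {a_par n / 2 + \<epsilon> / 2 ^ n .. a_par n / 2 + \<epsilon>}"

definition S2_set :: "nat \<Rightarrow> real \<Rightarrow> real set" where
  "S2_set n \<epsilon> = {a_par n + 2 * \<epsilon> .. 1 / 2}"

definition S3_set :: "nat \<Rightarrow> real \<Rightarrow> real set" where
  "S3_set n \<epsilon> = {d_par n .. d_par n + 2 * \<epsilon>}"

definition T1_set :: "nat \<Rightarrow> real \<Rightarrow> real set" where
  "T1_set n \<epsilon> = uminus ` S1_set n \<epsilon>"

definition T2_set :: "nat \<Rightarrow> real \<Rightarrow> real set" where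
  "T2_set n \<epsilon> = uminus ` S2_set n \<epsilon>"

definition T3_set :: "nat \<Rightarrow> real \<Rightarrow> real set" where
  "T3_set n \<epsilon> = uminus ` S3_set n \<epsilon>"

fun E_set :: "nat \<Rightarrow> real \<Rightarrow> nat \<Rightarrow> real set"
  and F_set :: "nat \<Rightarrow> real \<Rightarrow> nat \<Rightarrow> real set" where
  "E_set n \<epsilon> 0 = (\<lambda>x. x + 2 ^ (n - 2)) ` S1_set n \<epsilon>"
| "E_set n \<epsilon> (Suc l) = (\<lambda>x. x + 2 ^ (n - 2)) ` F_set n \<epsilon> l"
| "F_set n \<epsilon> l = (\<lambda>x. 1 / 2 ^ (n + l + 1) * x) ` E_set n \<epsilon> l"

definition G_set :: "nat \<Rightarrow> real \<Rightarrow> nat \<Rightarrow> real set" where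
  "G_set n \<epsilon> l = uminus ` E_set n \<epsilon> l"

definition H_set :: "nat \<Rightarrow> real \<Rightarrow> nat \<Rightarrow> real set" where
  "H_set n \<epsilon> l = uminus ` F_set n \<epsilon> l"

definition K_set :: "nat \<Rightarrow> real \<Rightarrow> real set" where
  "K_set n \<epsilon> =
     (R2_ivl n - (\<Union>l. E_set n \<epsilon> l)) \<union> (\<Union>l. F_set n \<epsilon> l)
       \<union> (S1_set n \<epsilon> \<union> S2_set n \<epsilon> \<union> S3_set n \<epsilon>)
     \<union> (L2_ivl n - (\<Union>l. G_set n \<epsilon> l)) \<union> (\<Union>l. H_set n \<epsilon> l)
       \<union> (T1_set n \<epsilon> \<union> T2_set n \<epsilon> \<union> T3_set n \<epsilon>)"

end

theory Submission
  imports Defs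
begin

text \<open>
  A bounded Borel set \<open>K\<close> is a wavelet set as soon as almost every point
  of the line has exactly one integer translate in \<open>K\<close>, and almost every point has exactly one
  dilate by a power of two in \<open>K\<close>. By the first tiling the exponentials \<open>e^(2 pi i k x)\<close> restricted
  to \<open>K\<close> form an orthonormal basis of \<open>L^2(K)\<close>, so their dilates form bases of \<open>L^2(2^j K)\<close> for every
  \<open>j\<close>. By the second tiling \<open>L^2\<close> of the line is the orthogonal sum of these spaces, and the union of
  the bases is a basis. The inverse Fourier transform turns it into the wavelet system generated
  by the inverse transform of the indicator of \<open>K\<close>. This is the theorem \<open>wavelet_set\<close> of the locale
  \<open>wavelet_tiling\<close>.

  Two facts carry this argument. The first is that exponentials are dense in \<open>L^2\<close> of any
  bounded set that meets its translates in null sets (\<open>exponentials_dense_on_packing_set\<close>); it is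
  reduced to the Weierstrass theorem on \<open>[-1,1]\<close> and a Dynkin system argument. The second is
  Plancherel's theorem, only for functions of compact support (\<open>Plancherel_compact_support\<close>). If
  \<open>f\<close> lives on an interval of length \<open>T\<close>, then the values of its transform at \<open>s + k/T\<close>, for integers
  \<open>k\<close>, are the Fourier coefficients of \<open>e^(-2 pi i s x) f(x)\<close>. Parseval's identity gives their square
  sum, and integrating over \<open>0 \<le> s < 1/T\<close> gives Plancherel. Together with the adjointness of
  the two transforms it yields \<open>sq_dist_fourier_eq\<close>: the distance from the transform of \<open>f\<close> to \<open>g\<close> equals the
  distance from \<open>f\<close> to the inverse transform of \<open>g\<close>. This single identity moves density from the frequency
  side to the time side and also identifies the Fourier transform of the wavelet.

  Put \<open>N = 2^(n-2)\<close>, \<open>a = a_n\<close> and \<open>d = d_n\<close>, so that \<open>d = N + a = 4 N a\<close>. The union of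
  \<open>[a, 1/2]\<close>, \<open>[N, d]\<close> and their negatives tiles in both ways: subtracting \<open>N\<close> takes \<open>[N, d]\<close> to
  \<open>[0, a]\<close>, and multiplying by \<open>2 N\<close> takes \<open>[a, 1/2]\<close> to \<open>[d/2, N]\<close>. Replacing \<open>[a, a + 2 \<epsilon>]\<close> by its
  translate \<open>S_3\<close> preserves the translation tiling. It leaves a gap in the dilation tiling, which \<open>S_1\<close>
  fills. But \<open>S_1\<close> collides with its translate \<open>E_0\<close>, so \<open>E_0\<close> is removed. To repair the dilation tiling
  the dilate \<open>F_0\<close> of \<open>E_0\<close> is inserted; it collides with \<open>E_1\<close>, and so on. The repairs \<open>F_l\<close> lie in
  disjoint intervals that shrink to \<open>0\<close>, so the procedure is consistent and \<open>0\<close> becomes an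
  accumulation point. All end points lie in the countable set of numbers \<open>q + r \<epsilon>\<close> with rational
  \<open>q\<close> and \<open>r\<close>. This set is invariant under integer translations and under dilations by powers of two, and off it
  both tilings hold exactly (\<open>translation_tiling\<close>, \<open>dilation_tiling\<close>).
\<close>

section \<open>Closed spans of square-integrable functions\<close>

lemma cmod_diff_sq_le: "(cmod (a - c))\<^sup>2 \<le> 2 * (cmod (a - b))\<^sup>2 + 2 * (cmod (b - c))\<^sup>2"
proof -
  have "cmod (a - c) \<le> cmod (a - b) + cmod (b - c)"
    using norm_triangle_ineq[of "a - b" "b - c"] by simp
  then have "(cmod (a - c))\<^sup>2 \<le> (cmod (a - b) + cmod (b - c))\<^sup>2"
    by (intro power_mono) auto
  also have "\<dots> \<le> 2 * (cmod (a - b))\<^sup>2 + 2 * (cmod (b - c))\<^sup>2"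
    using sum_squares_bound[of "cmod (a - b)" "cmod (b - c)"]
    by (simp add: power2_sum)
  finally show ?thesis .
qed

lemma cmod_diff_sq:
  "(cmod (a - b))\<^sup>2 = (cmod a)\<^sup>2 - 2 * Re (cnj b * a) + (cmod b)\<^sup>2"
  by (simp only: cmod_power2) (simp add: power2_eq_square algebra_simps)

lemma borel_measurable_cnj [measurable (raw)]:
  "f \<in> borel_measurable M \<Longrightarrow> (\<lambda>x. cnj (f x)) \<in> borel_measurable M"
  by (rule borel_measurable_continuous_on[OF continuous_on_cnj[OF continuous_on_id]])

text \<open>The squared distance is an extended nonnegative integral, so that it is meaningful for all
  measurable functions and agrees with \<open>L2_dist_sq\<close> for Lebesgue measure.\<close>
definition sq_dist :: "'a measure \<Rightarrow> ('a \<Rightarrow> complex) \<Rightarrow> ('a \<Rightarrow> complex) \<Rightarrow> ennreal" where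
  "sq_dist M f g = (\<integral>\<^sup>+ x. ennreal ((cmod (f x - g x))\<^sup>2) \<partial>M)"

lemma sq_dist_triangle:
  assumes [measurable]: "f \<in> borel_measurable M" "g \<in> borel_measurable M" "h \<in> borel_measurable M"
  shows "sq_dist M f h \<le> 2 * sq_dist M f g + 2 * sq_dist M g h"
proof -
  have "sq_dist M f h \<le>
    (\<integral>\<^sup>+ x. 2 * ennreal ((cmod (f x - g x))\<^sup>2) + 2 * ennreal ((cmod (g x - h x))\<^sup>2) \<partial>M)"
    unfolding sq_dist_def
  proof (rule nn_integral_mono)
    fix x
    have "ennreal ((cmod (f x - h x))\<^sup>2)
        \<le> ennreal (2 * (cmod (f x - g x))\<^sup>2 + 2 * (cmod (g x - h x))\<^sup>2)"
      by (intro ennreal_leI cmod_diff_sq_le)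
    then show "ennreal ((cmod (f x - h x))\<^sup>2)
        \<le> 2 * ennreal ((cmod (f x - g x))\<^sup>2) + 2 * ennreal ((cmod (g x - h x))\<^sup>2)"
      by (simp add: ennreal_plus ennreal_mult)
  qed
  also have "\<dots> = 2 * sq_dist M f g + 2 * sq_dist M g h"
    unfolding sq_dist_def by (simp add: nn_integral_add nn_integral_cmult)
  finally show ?thesis .
qed

lemma sq_dist_cong_AE:
  assumes "AE x in M. f x = f' x" "AE x in M. g x = g' x"
  shows "sq_dist M f g = sq_dist M f' g'"
  unfolding sq_dist_def using assms by (intro nn_integral_cong_AE) auto

definition L2_closure :: "'a measure \<Rightarrow> ('a \<Rightarrow> complex) set \<Rightarrow> ('a \<Rightarrow> complex) set" where
  "L2_closure M V =
     {f \<in> borel_measurable M. \<forall>\<delta>>0. \<exists>g\<in>V. sq_dist M f g \<le> ennreal \<delta>}"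

locale measurable_function_space =
  fixes M :: "'a measure" and V :: "('a \<Rightarrow> complex) set"
  assumes meas: "V \<subseteq> borel_measurable M"
    and zero: "(\<lambda>x. 0) \<in> V"
    and add: "\<And>f g. f \<in> V \<Longrightarrow> g \<in> V \<Longrightarrow> (\<lambda>x. f x + g x) \<in> V"
    and scale: "\<And>c f. f \<in> V \<Longrightarrow> (\<lambda>x. c * f x) \<in> V"
begin

lemma subset_closure: "f \<in> V \<Longrightarrow> f \<in> L2_closure M V"
  using meas unfolding L2_closure_def sq_dist_def by (auto intro!: bexI[of _ f])

lemma closure_meas: "f \<in> L2_closure M V \<Longrightarrow> f \<in> borel_measurable M"
  by (simp add: L2_closure_def)

text \<open>Closedness of the closure is what allows approximation in stages: in every later density proof
  the approximants are themselves only limits of elements of \<open>V\<close>.\<close>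
lemma closure_closed:
  assumes f: "f \<in> borel_measurable M"
    and approx: "\<And>\<delta>. \<delta> > 0 \<Longrightarrow> \<exists>g\<in>L2_closure M V. sq_dist M f g \<le> ennreal \<delta>"
  shows "f \<in> L2_closure M V"
  unfolding L2_closure_def
proof (intro CollectI conjI allI impI f)
  fix \<delta> :: real assume \<delta>: "\<delta> > 0"
  obtain g where g: "g \<in> L2_closure M V" "sq_dist M f g \<le> ennreal (\<delta> / 4)"
    using approx[of "\<delta> / 4"] \<delta> by auto
  obtain h where h: "h \<in> V" "sq_dist M g h \<le> ennreal (\<delta> / 4)"
    using g(1) \<delta> unfolding L2_closure_def by (auto dest!: spec[of _ "\<delta> / 4"])
  have "sq_dist M f h \<le> 2 * sq_dist M f g + 2 * sq_dist M g h"
    using f h meas closure_meas[OF g(1)] by (intro sq_dist_triangle) auto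
  also have "\<dots> \<le> 2 * ennreal (\<delta> / 4) + 2 * ennreal (\<delta> / 4)"
    using g h by (intro add_mono mult_left_mono) auto
  also have "\<dots> = ennreal \<delta>"
    using \<delta> by (simp flip: ennreal_plus ennreal_numeral ennreal_mult)
  finally show "\<exists>g\<in>V. sq_dist M f g \<le> ennreal \<delta>" using h by auto
qed

lemma closure_add:
  assumes f: "f \<in> L2_closure M V" and g: "g \<in> L2_closure M V"
  shows "(\<lambda>x. f x + g x) \<in> L2_closure M V"
  unfolding L2_closure_def
proof (intro CollectI conjI allI impI)
  note [measurable] = closure_meas[OF f] closure_meas[OF g]
  show "(\<lambda>x. f x + g x) \<in> borel_measurable M" by measurable
  fix \<delta> :: real assume \<delta>: "\<delta> > 0"
  obtain f' where f': "f' \<in> V" "sq_dist M f f' \<le> ennreal (\<delta> / 4)"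
    using f \<delta> unfolding L2_closure_def by (auto dest!: spec[of _ "\<delta> / 4"])
  obtain g' where g': "g' \<in> V" "sq_dist M g g' \<le> ennreal (\<delta> / 4)"
    using g \<delta> unfolding L2_closure_def by (auto dest!: spec[of _ "\<delta> / 4"])
  have [measurable]: "f' \<in> borel_measurable M" "g' \<in> borel_measurable M"
    using f' g' meas by auto
  have "sq_dist M (\<lambda>x. f x + g x) (\<lambda>x. f' x + g' x)
      \<le> 2 * sq_dist M (\<lambda>x. f x + g x) (\<lambda>x. f' x + g x)
        + 2 * sq_dist M (\<lambda>x. f' x + g x) (\<lambda>x. f' x + g' x)"
    by (intro sq_dist_triangle) measurable
  also have "\<dots> = 2 * sq_dist M f f' + 2 * sq_dist M g g'"
    by (simp add: sq_dist_def)
  also have "\<dots> \<le> 2 * ennreal (\<delta> / 4) + 2 * ennreal (\<delta> / 4)"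
    using f' g' by (intro add_mono mult_left_mono) auto
  also have "\<dots> = ennreal \<delta>"
    using \<delta> by (simp flip: ennreal_plus ennreal_numeral ennreal_mult)
  finally show "\<exists>h\<in>V. sq_dist M (\<lambda>x. f x + g x) h \<le> ennreal \<delta>"
    using add[OF f'(1) g'(1)] by auto
qed

lemma closure_scale:
  assumes f: "f \<in> L2_closure M V"
  shows "(\<lambda>x. c * f x) \<in> L2_closure M V"
proof (cases "c = 0")
  case True
  then show ?thesis using subset_closure[OF zero] by simp
next
  case False
  note [measurable] = closure_meas[OF f]
  show ?thesis
    unfolding L2_closure_def
  proof (intro CollectI conjI allI impI)
    show "(\<lambda>x. c * f x) \<in> borel_measurable M" by measurable
    fix \<delta> :: real assume \<delta>: "\<delta> > 0"
    obtain g where g: "g \<in> V" "sq_dist M f g \<le> ennreal (\<delta> / (cmod c)\<^sup>2)"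
      using f \<delta> False unfolding L2_closure_def by (auto dest!: spec[of _ "\<delta> / (cmod c)\<^sup>2"])
    have [measurable]: "g \<in> borel_measurable M" using g meas by auto
    have "sq_dist M (\<lambda>x. c * f x) (\<lambda>x. c * g x) = ennreal ((cmod c)\<^sup>2) * sq_dist M f g"
      unfolding sq_dist_def
      by (subst nn_integral_cmult[symmetric])
         (auto simp: norm_mult power_mult_distrib ennreal_mult simp flip: right_diff_distrib)
    also have "\<dots> \<le> ennreal ((cmod c)\<^sup>2) * ennreal (\<delta> / (cmod c)\<^sup>2)"
      using g by (intro mult_left_mono) auto
    also have "\<dots> = ennreal \<delta>"
      using \<delta> False by (simp flip: ennreal_mult)
    finally show "\<exists>h\<in>V. sq_dist M (\<lambda>x. c * f x) h \<le> ennreal \<delta>"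
      using scale[OF g(1)] by auto
  qed
qed

lemma closure_sum:
  "finite A \<Longrightarrow> (\<And>i. i \<in> A \<Longrightarrow> f i \<in> L2_closure M V) \<Longrightarrow> (\<lambda>x. \<Sum>i\<in>A. f i x) \<in> L2_closure M V"
  by (induction A rule: finite_induct) (auto intro: closure_add subset_closure zero)

text \<open>Dominated convergence in \<open>L\<^sup>2\<close>: the differences are dominated by \<open>2 w\<close>, whence the factor
  \<open>4\<close> in front of the integrable majorant.\<close>
lemma closure_limit:
  assumes F: "\<And>i::nat. F i \<in> L2_closure M V"
    and f[measurable]: "f \<in> borel_measurable M"
    and lim: "AE x in M. (\<lambda>i. F i x) \<longlonglongrightarrow> f x"
    and bound: "\<And>i. AE x in M. cmod (F i x) \<le> w x"
    and w[measurable]: "w \<in> borel_measurable M" and w_fin: "(\<integral>\<^sup>+ x. ennreal ((w x)\<^sup>2) \<partial>M) < \<infinity>"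
  shows "f \<in> L2_closure M V"
proof (rule closure_closed[OF f])
  have [measurable]: "\<And>i. F i \<in> borel_measurable M" using F closure_meas by auto
  have bound_f: "AE x in M. cmod (f x) \<le> w x"
  proof -
    have "AE x in M. \<forall>i. cmod (F i x) \<le> w x" using bound by (simp add: AE_all_countable)
    with lim show ?thesis
    proof eventually_elim
      case (elim x)
      then show ?case by (intro tendsto_upperbound[OF tendsto_norm[OF elim(1)]]) auto
    qed
  qed
  have "(\<lambda>i. sq_dist M f (F i)) \<longlonglongrightarrow> (\<integral>\<^sup>+ x. 0 \<partial>M)"
    unfolding sq_dist_def
  proof (rule nn_integral_dominated_convergence[where w = "\<lambda>x. 4 * ennreal ((w x)\<^sup>2)"])
    show "(\<integral>\<^sup>+ x. 4 * ennreal ((w x)\<^sup>2) \<partial>M) < \<infinity>"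
      using w_fin by (simp add: nn_integral_cmult ennreal_mult_less_top)
    show "AE x in M. ennreal ((cmod (f x - F i x))\<^sup>2) \<le> 4 * ennreal ((w x)\<^sup>2)" for i
      using bound_f bound[of i]
    proof eventually_elim
      case (elim x)
      have "cmod (f x - F i x) \<le> 2 * w x"
        using norm_triangle_ineq4[of "f x" "F i x"] elim by simp
      then have "(cmod (f x - F i x))\<^sup>2 \<le> (2 * w x)\<^sup>2" by (intro power_mono) auto
      then have "ennreal ((cmod (f x - F i x))\<^sup>2) \<le> ennreal (4 * (w x)\<^sup>2)"
        by (intro ennreal_leI) (simp add: power_mult_distrib)
      then show ?case by (simp add: ennreal_mult)
    qed
    show "AE x in M. (\<lambda>i. ennreal ((cmod (f x - F i x))\<^sup>2)) \<longlonglongrightarrow> 0"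
      using lim
    proof eventually_elim
      case (elim x)
      have "(\<lambda>i. (cmod (f x - F i x))\<^sup>2) \<longlonglongrightarrow> (cmod (f x - f x))\<^sup>2"
        by (intro tendsto_intros elim)
      then show ?case by (simp flip: ennreal_0)
    qed
  qed auto
  then have lim0: "(\<lambda>i. sq_dist M f (F i)) \<longlonglongrightarrow> 0" by simp
  fix \<delta> :: real assume "\<delta> > 0"
  then have "\<forall>\<^sub>F i in sequentially. sq_dist M f (F i) < ennreal \<delta>"
    using order_tendstoD(2)[OF lim0, of "ennreal \<delta>"] by simp
  then obtain i where "sq_dist M f (F i) < ennreal \<delta>"
    by (auto simp: eventually_sequentially)
  then show "\<exists>g\<in>L2_closure M V. sq_dist M f g \<le> ennreal \<delta>"
    using F[of i] by (auto intro: less_imp_le)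
qed

lemma closure_cong_AE:
  assumes "f \<in> L2_closure M V" "g \<in> borel_measurable M" "AE x in M. f x = g x"
  shows "g \<in> L2_closure M V"
proof -
  have "sq_dist M g h = sq_dist M f h" for h
    using assms(3) by (intro sq_dist_cong_AE) auto
  then show ?thesis using assms unfolding L2_closure_def by auto
qed

text \<open>The sets whose indicator lies in the closure form a Dynkin system: complements correspond to
  \<open>1 - f\<close>, countable disjoint unions to dominated limits of finite sums.\<close>
lemma indicator_in_closure:
  assumes fin: "finite_measure M"
    and sets_M: "sets M = sigma_sets (space M) G" and G: "Int_stable G" "G \<subseteq> Pow (space M)"
    and one: "(\<lambda>x. 1) \<in> L2_closure M V"
    and gen: "\<And>A. A \<in> G \<Longrightarrow> (\<lambda>x. indicator A x) \<in> L2_closure M V"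
    and A: "A \<in> sets M"
  shows "(\<lambda>x. indicator A x) \<in> L2_closure M V"
proof -
  interpret finite_measure M by (rule fin)
  from A have "A \<in> sigma_sets (space M) G" using sets_M by simp
  with G show ?thesis
  proof (induction rule: sigma_sets_induct_disjoint)
    case (basic A)
    then show ?case by (rule gen)
  next
    case empty
    show ?case using subset_closure[OF zero] by simp
  next
    case (compl A)
    have "(\<lambda>x. 1 + (-1) * indicator A x) \<in> L2_closure M V"
      by (intro closure_add one closure_scale compl)
    moreover have "(\<lambda>x. indicator (space M - A) x :: complex) \<in> borel_measurable M"
      using compl sets_M by (intro borel_measurable_indicator) auto
    ultimately show ?case
      by (rule closure_cong_AE) (auto simp: indicator_def)
  next
    case (union A)
    let ?F = "\<lambda>n x. \<Sum>i<n. indicator (A i) x :: complex"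
    have eq: "?F n x = indicator (\<Union>i<n. A i) x" for n x
      using union(1) by (subst indicator_UN_disjoint) (auto simp: disjoint_family_on_def)
    show ?case
    proof (rule closure_limit[where F = ?F and w = "\<lambda>x. 1"])
      show "(\<lambda>x. ?F n x) \<in> L2_closure M V" for n
        using union by (intro closure_sum) auto
      show "(\<lambda>x. indicator (\<Union>i. A i) x :: complex) \<in> borel_measurable M"
        using union sets_M by (intro borel_measurable_indicator sets.countable_UN) auto
      show "AE x in M. (\<lambda>n. ?F n x) \<longlonglongrightarrow> indicator (\<Union>i. A i) x"
        unfolding eq by (intro AE_I2 LIMSEQ_indicator_UN)
      show "AE x in M. cmod (?F n x) \<le> 1" for n
        unfolding eq by (auto simp: indicator_def)
    qed (auto simp flip: less_top)
  qed
qed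

text \<open>Simple functions are finite sums of scaled indicators, and every square-integrable function is a
  dominated limit of simple functions.\<close>
theorem dense_from_generator:
  assumes fin: "finite_measure M"
    and sets_M: "sets M = sigma_sets (space M) G" and G: "Int_stable G" "G \<subseteq> Pow (space M)"
    and one: "(\<lambda>x. 1) \<in> L2_closure M V"
    and gen: "\<And>A. A \<in> G \<Longrightarrow> (\<lambda>x. indicator A x) \<in> L2_closure M V"
    and f[measurable]: "f \<in> borel_measurable M" and L2: "(\<integral>\<^sup>+ x. ennreal ((cmod (f x))\<^sup>2) \<partial>M) < \<infinity>"
  shows "f \<in> L2_closure M V"
proof -
  from borel_measurable_implies_sequence_metric[OF f, of 0]
  obtain F where F: "\<And>i. simple_function M (F i)"
      "\<And>x. x \<in> space M \<Longrightarrow> (\<lambda>i. F i x) \<longlonglongrightarrow> f x"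
      "\<And>i x. x \<in> space M \<Longrightarrow> cmod (F i x) \<le> 2 * cmod (f x)"
    unfolding dist_0_norm by (metis dist_0_norm dist_commute)
  show ?thesis
  proof (rule closure_limit[where F = F and w = "\<lambda>x. 2 * cmod (f x)"])
    fix i
    have [measurable]: "F i \<in> borel_measurable M" using F(1) by (rule borel_measurable_simple_function)
    have "(\<lambda>x. \<Sum>y\<in>F i ` space M. y * indicator (F i -` {y} \<inter> space M) x) \<in> L2_closure M V"
      using F(1)[of i] by (intro closure_sum closure_scale indicator_in_closure[OF fin sets_M G one gen])
        (auto simp: simple_function_def)
    then show "F i \<in> L2_closure M V"
    proof (rule closure_cong_AE)
      show "AE x in M. (\<Sum>y\<in>F i ` space M. y * indicator (F i -` {y} \<inter> space M) x) = F i x"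
      proof (rule AE_I2)
        fix x assume x: "x \<in> space M"
        have "(\<Sum>y\<in>F i ` space M. y * indicator (F i -` {y} \<inter> space M) x)
            = (\<Sum>y\<in>F i ` space M. if y = F i x then F i x else 0)"
          using x by (intro sum.cong) (auto simp: indicator_def)
        also have "\<dots> = F i x"
          using F(1)[of i] x by (simp add: simple_function_def)
        finally show "(\<Sum>y\<in>F i ` space M. y * indicator (F i -` {y} \<inter> space M) x) = F i x" .
      qed
    qed measurable
  next
    show "(\<integral>\<^sup>+ x. ennreal ((2 * cmod (f x))\<^sup>2) \<partial>M) < \<infinity>"
      using L2 by (simp add: power_mult_distrib ennreal_mult nn_integral_cmult ennreal_mult_less_top)
  qed (use F in auto)
qed

end

definition finite_span :: "('i \<Rightarrow> 'a \<Rightarrow> complex) \<Rightarrow> ('a \<Rightarrow> complex) set" where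
  "finite_span u = {f. \<exists>J c. finite J \<and> f = (\<lambda>x. \<Sum>i\<in>J. c i * u i x)}"

lemma finite_span_space:
  assumes u: "\<And>i. u i \<in> borel_measurable M"
  shows "measurable_function_space M (finite_span u)"
proof
  show "finite_span u \<subseteq> borel_measurable M"
    using u unfolding finite_span_def by auto
  show "(\<lambda>x. 0) \<in> finite_span u"
    unfolding finite_span_def by (auto intro!: exI[of _ "{}"])
next
  fix f g assume "f \<in> finite_span u" "g \<in> finite_span u"
  then obtain J c J' c' where *: "finite J" "f = (\<lambda>x. \<Sum>k\<in>J. c k * u k x)"
    "finite J'" "g = (\<lambda>x. \<Sum>k\<in>J'. c' k * u k x)" unfolding finite_span_def by blast
  let ?d = "\<lambda>k. (if k \<in> J then c k else 0) + (if k \<in> J' then c' k else 0)"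
  have "f x + g x = (\<Sum>k\<in>J\<union>J'. ?d k * u k x)" for x
  proof -
    have "f x = (\<Sum>k\<in>J\<union>J'. (if k \<in> J then c k else 0) * u k x)"
      unfolding *(2) using *(1,3) by (intro sum.mono_neutral_cong_left) auto
    moreover have "g x = (\<Sum>k\<in>J\<union>J'. (if k \<in> J' then c' k else 0) * u k x)"
      unfolding *(4) using *(1,3) by (intro sum.mono_neutral_cong_left) auto
    ultimately show ?thesis by (simp add: distrib_right sum.distrib)
  qed
  then show "(\<lambda>x. f x + g x) \<in> finite_span u"
    unfolding finite_span_def
    by (intro CollectI exI[of _ "J \<union> J'"] exI[of _ ?d] conjI ext) (use *(1,3) in auto)
next
  fix a f assume "f \<in> finite_span u"
  then obtain J c where *: "finite J" "f = (\<lambda>x. \<Sum>k\<in>J. c k * u k x)" unfolding finite_span_def by blast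
  then have "(\<lambda>x. a * f x) = (\<lambda>x. \<Sum>k\<in>J. (a * c k) * u k x)"
    by (simp add: sum_distrib_left mult.assoc)
  then show "(\<lambda>x. a * f x) \<in> finite_span u"
    unfolding finite_span_def
    by (intro CollectI exI[of _ J] exI[of _ "\<lambda>k. a * c k"] conjI) (use *(1) in auto)
qed

lemma member_finite_span: "u i \<in> finite_span u"
  unfolding finite_span_def by (auto intro!: exI[of _ "{i}"] exI[of _ "\<lambda>_. 1"])

section \<open>Orthonormal systems and Parseval's identity\<close>
definition square_integrable :: "'a measure \<Rightarrow> ('a \<Rightarrow> complex) \<Rightarrow> bool" where
  "square_integrable M f \<longleftrightarrow> f \<in> borel_measurable M \<and> integrable M (\<lambda>x. (cmod (f x))\<^sup>2)"

definition inner_prod :: "'a measure \<Rightarrow> ('a \<Rightarrow> complex) \<Rightarrow> ('a \<Rightarrow> complex) \<Rightarrow> complex" where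
  "inner_prod M f g = (LINT x|M. f x * cnj (g x))"

definition sq_norm :: "'a measure \<Rightarrow> ('a \<Rightarrow> complex) \<Rightarrow> real" where
  "sq_norm M f = (LINT x|M. (cmod (f x))\<^sup>2)"

lemma square_integrable_measurable: "square_integrable M f \<Longrightarrow> f \<in> borel_measurable M"
  by (simp add: square_integrable_def)

lemma square_integrable_iff_finite:
  "square_integrable M f \<longleftrightarrow>
     f \<in> borel_measurable M \<and> (\<integral>\<^sup>+ x. ennreal ((cmod (f x))\<^sup>2) \<partial>M) < \<infinity>"
  by (auto simp: square_integrable_def integrable_iff_bounded)

lemma nn_integral_eq_sq_norm:
  "square_integrable M f \<Longrightarrow> (\<integral>\<^sup>+ x. ennreal ((cmod (f x))\<^sup>2) \<partial>M) = ennreal (sq_norm M f)"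
  by (simp add: square_integrable_def sq_norm_def nn_integral_eq_integral)

lemma sq_norm_nonneg: "sq_norm M f \<ge> 0"
  by (simp add: sq_norm_def)

lemma integrable_product:
  assumes f: "square_integrable M f" and g: "square_integrable M g"
  shows "integrable M (\<lambda>x. f x * cnj (g x))"
proof (rule Bochner_Integration.integrable_bound)
  show "integrable M (\<lambda>x. (cmod (f x))\<^sup>2 + (cmod (g x))\<^sup>2)"
    using f g by (auto simp: square_integrable_def)
  note [measurable] = square_integrable_measurable[OF f] square_integrable_measurable[OF g]
  show "(\<lambda>x. f x * cnj (g x)) \<in> borel_measurable M" by measurable
  have "cmod (f x) * cmod (g x) \<le> (cmod (f x))\<^sup>2 + (cmod (g x))\<^sup>2" for x
    using sum_squares_bound[of "cmod (f x)" "cmod (g x)"]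
      mult_nonneg_nonneg[OF norm_ge_zero norm_ge_zero, of "f x" "g x"]
    unfolding mult.assoc by linarith
  then show "AE x in M. norm (f x * cnj (g x)) \<le> norm ((cmod (f x))\<^sup>2 + (cmod (g x))\<^sup>2)"
    by (auto simp: norm_mult)
qed

lemma square_integrable_add:
  assumes f: "square_integrable M f" and g: "square_integrable M g"
  shows "square_integrable M (\<lambda>x. f x + g x)"
  unfolding square_integrable_def
proof
  note [measurable] = square_integrable_measurable[OF f] square_integrable_measurable[OF g]
  show m: "(\<lambda>x. f x + g x) \<in> borel_measurable M" by measurable
  show "integrable M (\<lambda>x. (cmod (f x + g x))\<^sup>2)"
  proof (rule Bochner_Integration.integrable_bound)
    show "integrable M (\<lambda>x. 2 * (cmod (f x))\<^sup>2 + 2 * (cmod (g x))\<^sup>2)"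
      using f g by (auto simp: square_integrable_def)
    show "AE x in M. norm ((cmod (f x + g x))\<^sup>2) \<le> norm (2 * (cmod (f x))\<^sup>2 + 2 * (cmod (g x))\<^sup>2)"
      using cmod_diff_sq_le[of "f x" "- g x" 0 for x] by auto
  qed measurable
qed

lemma square_integrable_scale:
  "square_integrable M f \<Longrightarrow> square_integrable M (\<lambda>x. c * f x)"
  by (auto simp: square_integrable_def norm_mult power_mult_distrib)

lemma square_integrable_diff:
  "square_integrable M f \<Longrightarrow> square_integrable M g \<Longrightarrow> square_integrable M (\<lambda>x. f x - g x)"
  using square_integrable_add[of M f "\<lambda>x. (-1) * g x"] square_integrable_scale[of M g "-1"] by simp

lemma square_integrable_sum:
  "finite J \<Longrightarrow> (\<And>i. i \<in> J \<Longrightarrow> square_integrable M (f i)) \<Longrightarrow> square_integrable M (\<lambda>x. \<Sum>i\<in>J. f i x)"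
proof (induction J rule: finite_induct)
  case empty
  show ?case by (simp add: square_integrable_def)
next
  case (insert i J)
  then have "square_integrable M (\<lambda>x. f i x + (\<Sum>i\<in>J. f i x))"
    by (intro square_integrable_add) auto
  with insert show ?case by simp
qed

lemma inner_prod_sum_right:
  assumes "finite J" "square_integrable M f" "\<And>i. i \<in> J \<Longrightarrow> square_integrable M (u i)"
  shows "inner_prod M f (\<lambda>x. \<Sum>i\<in>J. c i * u i x) = (\<Sum>i\<in>J. cnj (c i) * inner_prod M f (u i))"
proof -
  have "inner_prod M f (\<lambda>x. \<Sum>i\<in>J. c i * u i x)
      = (LINT x|M. (\<Sum>i\<in>J. cnj (c i) * (f x * cnj (u i x))))"
    unfolding inner_prod_def by (intro Bochner_Integration.integral_cong) (auto simp: sum_distrib_left mult_ac)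
  also have "\<dots> = (\<Sum>i\<in>J. cnj (c i) * inner_prod M f (u i))"
    unfolding inner_prod_def using assms
    by (subst Bochner_Integration.integral_sum)
      (auto intro!: integrable_mult_right integrable_product)
  finally show ?thesis .
qed

lemma inner_prod_commute: "inner_prod M g f = cnj (inner_prod M f g)"
  unfolding inner_prod_def by (simp add: mult.commute flip: Bochner_Integration.integral_cnj)

lemma inner_prod_self: "inner_prod M f f = of_real (sq_norm M f)"
  unfolding inner_prod_def sq_norm_def
  by (simp add: complex_norm_square del: of_real_power flip: integral_complex_of_real)

lemma sq_norm_diff:
  assumes f: "square_integrable M f" and g: "square_integrable M g"
  shows "sq_norm M (\<lambda>x. f x - g x) = sq_norm M f - 2 * Re (inner_prod M f g) + sq_norm M g"
proof -
  have "(cmod (f x - g x))\<^sup>2 = (cmod (f x))\<^sup>2 - 2 * Re (f x * cnj (g x)) + (cmod (g x))\<^sup>2" for x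
    by (simp only: cmod_diff_sq mult.commute)
  then show ?thesis
    using f g integrable_product[OF f g]
    unfolding sq_norm_def inner_prod_def square_integrable_def
    by (simp del: times_complex.sel add: integrable_Re)
qed

lemma sq_dist_eq:
  "square_integrable M f \<Longrightarrow> square_integrable M g \<Longrightarrow>
     sq_dist M f g = ennreal (sq_norm M (\<lambda>x. f x - g x))"
  unfolding sq_dist_def by (rule nn_integral_eq_sq_norm) (rule square_integrable_diff)

text \<open>Completing the square: among all combinations with support \<open>J\<close> the one with the Fourier
  coefficients as weights is closest to \<open>f\<close>. Both Bessel's inequality and the converse
  estimate in Parseval's identity are read off from this formula.\<close>
lemma sq_norm_diff_orthonormal:
  assumes J: "finite J" and f: "square_integrable M f" and u: "\<And>i. i \<in> J \<Longrightarrow> square_integrable M (u i)"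
    and on: "\<And>i j. i \<in> J \<Longrightarrow> j \<in> J \<Longrightarrow> inner_prod M (u i) (u j) = (if i = j then 1 else 0)"
  shows "sq_norm M (\<lambda>x. f x - (\<Sum>i\<in>J. c i * u i x))
    = sq_norm M f - (\<Sum>i\<in>J. (cmod (inner_prod M f (u i)))\<^sup>2)
      + (\<Sum>i\<in>J. (cmod (c i - inner_prod M f (u i)))\<^sup>2)"
proof -
  let ?s = "\<lambda>x. \<Sum>i\<in>J. c i * u i x" and ?a = "\<lambda>i. inner_prod M f (u i)"
  have s: "square_integrable M ?s"
    using J u by (intro square_integrable_sum square_integrable_scale)
  have us: "inner_prod M (u j) ?s = cnj (c j)" if "j \<in> J" for j
  proof -
    have "inner_prod M (u j) ?s = (\<Sum>i\<in>J. cnj (c i) * inner_prod M (u j) (u i))"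
      using J u that by (intro inner_prod_sum_right)
    also have "\<dots> = (\<Sum>i\<in>J. if i = j then cnj (c j) else 0)"
      using that by (intro sum.cong) (auto simp: on)
    finally show ?thesis using J that by simp
  qed
  have "inner_prod M ?s ?s = (\<Sum>i\<in>J. cnj (c i) * inner_prod M ?s (u i))"
    using J u s by (intro inner_prod_sum_right)
  also have "\<dots> = (\<Sum>i\<in>J. of_real ((cmod (c i))\<^sup>2))"
    by (intro sum.cong refl, subst inner_prod_commute)
      (simp add: us complex_norm_square mult.commute del: of_real_power)
  finally have "complex_of_real (sq_norm M ?s) = of_real (\<Sum>i\<in>J. (cmod (c i))\<^sup>2)"
    by (simp add: inner_prod_self)
  then have ns: "sq_norm M ?s = (\<Sum>i\<in>J. (cmod (c i))\<^sup>2)"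
    by (simp only: of_real_eq_iff)
  have fs: "inner_prod M f ?s = (\<Sum>i\<in>J. cnj (c i) * ?a i)"
    using J u f by (intro inner_prod_sum_right)
  have *: "(cmod (c i - ?a i))\<^sup>2 = (cmod (c i))\<^sup>2 - 2 * Re (cnj (c i) * ?a i) + (cmod (?a i))\<^sup>2" for i
    using cmod_diff_sq[of "?a i" "c i"] by (simp add: norm_minus_commute)
  have "(\<Sum>i\<in>J. (cmod (c i - ?a i))\<^sup>2)
      = (\<Sum>i\<in>J. (cmod (c i))\<^sup>2) - 2 * Re (\<Sum>i\<in>J. cnj (c i) * ?a i) + (\<Sum>i\<in>J. (cmod (?a i))\<^sup>2)"
    unfolding * by (simp add: sum.distrib sum_subtractf sum_distrib_left)
  then show ?thesis
    unfolding sq_norm_diff[OF f s] fs ns by simp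
qed

text \<open>The sum is taken along an enumeration \<open>q\<close> of the index set so that monotone convergence for
  series of integrals applies to it directly.\<close>
theorem Parseval:
  fixes u :: "'i \<Rightarrow> 'a \<Rightarrow> complex" and q :: "nat \<Rightarrow> 'i"
  assumes f: "square_integrable M f" and u: "\<And>i. square_integrable M (u i)"
    and on: "\<And>i j. inner_prod M (u i) (u j) = (if i = j then 1 else 0)"
    and q: "bij q"
    and span: "\<And>\<delta>. \<delta> > 0 \<Longrightarrow> \<exists>J c. finite J \<and> sq_dist M f (\<lambda>x. \<Sum>i\<in>J. c i * u i x) \<le> ennreal \<delta>"
  shows "(\<Sum>i. ennreal ((cmod (inner_prod M f (u (q i))))\<^sup>2)) = ennreal (sq_norm M f)"
proof -
  let ?a = "\<lambda>i. (cmod (inner_prod M f (u i)))\<^sup>2"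
  have part: "(\<Sum>i<n. ennreal (?a (q i))) = ennreal (sum ?a (q ` {..<n}))" for n
    using q by (subst sum_ennreal) (auto simp: sum.reindex bij_def inj_on_def)
  have bessel: "sum ?a J \<le> sq_norm M f" if "finite J" for J
    using sq_norm_diff_orthonormal[OF that f u on, where c = "\<lambda>i. inner_prod M f (u i)"]
      sq_norm_nonneg[of M "\<lambda>x. f x - (\<Sum>i\<in>J. inner_prod M f (u i) * u i x)"] by simp
  have "(\<Sum>i. ennreal (?a (q i))) \<le> ennreal (sq_norm M f)"
    unfolding suminf_eq_SUP part by (intro SUP_least ennreal_leI bessel) auto
  moreover have "ennreal (sq_norm M f) \<le> (\<Sum>i. ennreal (?a (q i)))"
  proof (rule ennreal_le_epsilon)
    fix \<delta> :: real assume \<delta>: "\<delta> > 0"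
    obtain J c where J: "finite J" "sq_dist M f (\<lambda>x. \<Sum>i\<in>J. c i * u i x) \<le> ennreal \<delta>"
      using span[OF \<delta>] by blast
    then have "sq_norm M (\<lambda>x. f x - (\<Sum>i\<in>J. c i * u i x)) \<le> \<delta>"
      using \<delta> f u by (subst (asm) sq_dist_eq)
        (auto intro!: square_integrable_sum square_integrable_scale simp: ennreal_le_iff)
    then have 1: "sq_norm M f \<le> sum ?a J + \<delta>"
      using sq_norm_diff_orthonormal[OF J(1) f u on, where c = c]
        sum_nonneg[of J "\<lambda>i. (cmod (c i - inner_prod M f (u i)))\<^sup>2"] by simp
    have "finite (inv q ` J)" using J by simp
    then obtain n where n: "inv q ` J \<subseteq> {..<n}" by (meson finite_nat_iff_bounded)
    have "J \<subseteq> q ` {..<n}"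
    proof
      fix j assume "j \<in> J"
      then have "inv q j \<in> {..<n}" "q (inv q j) = j"
        using n q by (auto simp: bij_def surj_f_inv_f)
      then show "j \<in> q ` {..<n}" by (metis imageI)
    qed
    then have "sum ?a J \<le> sum ?a (q ` {..<n})" by (intro sum_mono2) auto
    then have "ennreal (sum ?a J) \<le> (\<Sum>i. ennreal (?a (q i)))"
      unfolding suminf_eq_SUP part by (intro SUP_upper2[of n] ennreal_leI) auto
    moreover have "ennreal (sq_norm M f) \<le> ennreal (sum ?a J) + ennreal \<delta>"
      using 1 \<delta> by (simp add: sum_nonneg flip: ennreal_plus)
    ultimately show "ennreal (sq_norm M f) \<le> (\<Sum>i. ennreal (?a (q i))) + ennreal \<delta>"
      by (meson add_right_mono order_trans)
  qed
  ultimately show ?thesis by (rule antisym)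
qed

section \<open>Density of trigonometric polynomials\<close>
abbreviation wave :: "int \<Rightarrow> real \<Rightarrow> complex" where
  "wave k x \<equiv> cis (2 * pi * of_int k * x)"

lemma cis_measurable [measurable (raw)]:
  "f \<in> borel_measurable M \<Longrightarrow> (\<lambda>x. cis (f x)) \<in> borel_measurable M"
  by (rule borel_measurable_continuous_on[where f = cis]) (intro continuous_intros)

text \<open>The inductive presentation makes closure under products and under substitution into real
  polynomials a matter of induction.\<close>
inductive_set trig_polys :: "(real \<Rightarrow> complex) set" where
  monomial: "(\<lambda>x. c * wave k x) \<in> trig_polys"
| sum: "f \<in> trig_polys \<Longrightarrow> g \<in> trig_polys \<Longrightarrow> (\<lambda>x. f x + g x) \<in> trig_polys"

lemma trig_polys_const: "(\<lambda>x. c) \<in> trig_polys"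
  using monomial[of c 0] by simp

lemma trig_polys_measurable: "f \<in> trig_polys \<Longrightarrow> f \<in> borel_measurable borel"
  by (induction rule: trig_polys.induct) auto

lemma trig_polys_scale: "f \<in> trig_polys \<Longrightarrow> (\<lambda>x. c * f x) \<in> trig_polys"
proof (induction rule: trig_polys.induct)
  case (monomial d k)
  then show ?case using trig_polys.monomial[of "c * d" k] by (simp add: mult.assoc)
qed (simp add: distrib_left trig_polys.sum)

lemma trig_polys_mult_wave: "f \<in> trig_polys \<Longrightarrow> (\<lambda>x. c * wave k x * f x) \<in> trig_polys"
proof (induction rule: trig_polys.induct)
  case (monomial d l)
  have "(\<lambda>x. c * wave k x * (d * wave l x)) = (\<lambda>x. (c * d) * wave (k + l) x)"
    by (auto simp: cis_mult algebra_simps fun_eq_iff simp flip: cis_mult)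
  then show ?case using trig_polys.monomial[of "c * d" "k + l"] by simp
qed (simp add: distrib_left trig_polys.sum)

lemma trig_polys_mult: "f \<in> trig_polys \<Longrightarrow> g \<in> trig_polys \<Longrightarrow> (\<lambda>x. f x * g x) \<in> trig_polys"
  by (induction rule: trig_polys.induct) (auto simp: trig_polys_mult_wave distrib_right intro: trig_polys.sum)

lemma trig_polys_finite_span: "f \<in> trig_polys \<Longrightarrow> f \<in> finite_span wave"
proof (induction rule: trig_polys.induct)
  interpret measurable_function_space borel "finite_span wave"
    by (rule finite_span_space) measurable
  case (monomial c k)
  show ?case by (rule scale[OF member_finite_span])
next
  interpret measurable_function_space borel "finite_span wave"
    by (rule finite_span_space) measurable
  case (sum f g)
  then show ?case by (intro add)
qed

lemma real_polynomial_of_trig_poly: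
  assumes "real_polynomial_function p" "(\<lambda>x. complex_of_real (t x)) \<in> trig_polys"
  shows "(\<lambda>x. complex_of_real (p (t x))) \<in> trig_polys"
  using assms
proof (induction p rule: real_polynomial_function.induct)
  case (linear f)
  have "f s = f 1 * s" for s
    using linear_simps(5)[OF linear(1), of s 1] by (simp add: mult.commute)
  then have "(\<lambda>x. complex_of_real (f (t x))) = (\<lambda>x. of_real (f 1) * of_real (t x))"
    by (metis of_real_mult)
  then show ?case using trig_polys_scale[OF linear(2), of "of_real (f 1)"] by simp
qed (auto simp: trig_polys_const intro: trig_polys.sum trig_polys_mult)

text \<open>The clipped lines \<open>min 1 (max 0 (n s))\<close> increase to the indicator of \<open>s > 0\<close>; the \<open>n\<close>-th
  polynomial approximates the \<open>n\<close>-th of them uniformly within \<open>1/(n+1)\<close>.\<close>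
lemma polynomials_approximating_positivity:
  obtains p :: "nat \<Rightarrow> real \<Rightarrow> real" where "\<And>n. real_polynomial_function (p n)"
    and "\<And>s. s \<in> {-1..1} \<Longrightarrow> (\<lambda>n. p n s) \<longlonglongrightarrow> (if s > 0 then 1 else 0)"
    and "\<And>n s. s \<in> {-1..1} \<Longrightarrow> \<bar>p n s\<bar> \<le> 2"
proof -
  let ?\<phi> = "\<lambda>n s. min 1 (max 0 (real n * s))"
  have "\<exists>p. real_polynomial_function p \<and> (\<forall>s\<in>{-1..1}. \<bar>?\<phi> n s - p s\<bar> < 1 / real (Suc n))" for n
    by (rule Stone_Weierstrass_real_polynomial_function[of "{-1..1::real}" "?\<phi> n" "1 / real (Suc n)"])
      (auto intro!: continuous_intros)
  then obtain p where p: "\<And>n. real_polynomial_function (p n)"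
      "\<And>n s. s \<in> {-1..1} \<Longrightarrow> \<bar>?\<phi> n s - p n s\<bar> < 1 / real (Suc n)"
    by metis
  show thesis
  proof (rule that[OF p(1)])
    fix s :: real assume s: "s \<in> {-1..1}"
    have "(\<lambda>n. ?\<phi> n s) \<longlonglongrightarrow> (if s > 0 then 1 else 0)"
    proof (cases "s > 0")
      case True
      obtain m where m: "1 / s < real m" using reals_Archimedean2 by blast
      have "\<forall>\<^sub>F n in sequentially. ?\<phi> n s = 1"
        using eventually_ge_at_top[of m]
      proof eventually_elim
        case (elim n)
        have "1 < real m * s" using m True by (simp add: field_simps)
        also have "\<dots> \<le> real n * s" using elim True by (intro mult_right_mono) auto
        finally show ?case by simp
      qed
      then show ?thesis using True by (simp add: tendsto_eventually)
    next
      case False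
      then have "real n * s \<le> 0" for n by (simp add: mult_nonneg_nonpos)
      then have "?\<phi> n s = 0" for n by (simp add: max_absorb1)
      then show ?thesis using False by simp
    qed
    moreover have "(\<lambda>n. ?\<phi> n s - p n s) \<longlonglongrightarrow> 0"
    proof (rule Lim_null_comparison)
      show "\<forall>\<^sub>F n in sequentially. norm (?\<phi> n s - p n s) \<le> 1 / real (Suc n)"
        using p(2)[OF s] unfolding real_norm_def by (intro always_eventually allI less_imp_le)
      show "(\<lambda>n. 1 / real (Suc n)) \<longlonglongrightarrow> 0" using LIMSEQ_inverse_real_of_nat by (simp add: inverse_eq_divide)
    qed
    ultimately have "(\<lambda>n. ?\<phi> n s - (?\<phi> n s - p n s)) \<longlonglongrightarrow> (if s > 0 then 1 else 0) - 0"
      by (rule tendsto_diff)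
    then show "(\<lambda>n. p n s) \<longlonglongrightarrow> (if s > 0 then 1 else 0)" by simp
  next
    fix n and s :: real assume s: "s \<in> {-1..1}"
    have "1 / real (Suc n) \<le> 1" by simp
    moreover have "\<bar>?\<phi> n s\<bar> \<le> 1" by simp
    ultimately show "\<bar>p n s\<bar> \<le> 2" using p(2)[OF s, of n] by linarith
  qed
qed

text \<open>A trigonometric polynomial with values in \<open>[-1,1]\<close> whose sign detects the interval \<open>(a, 1)\<close> within
  one period. Composed with polynomials approximating the indicator of the positive numbers, it
  produces trigonometric polynomials that converge to the indicator of \<open>(a, 1)\<close>.\<close>
lemma trig_poly_positive_iff:
  assumes a: "0 \<le> a" "a < 1"
  defines "t \<equiv> \<lambda>y. sin (pi * (y - a)) * sin (pi * y)"
  shows "(\<lambda>y. complex_of_real (t y)) \<in> trig_polys"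
    and "\<And>y. y \<in> {0..<1} \<Longrightarrow> t y > 0 \<longleftrightarrow> y > a"
    and "\<And>y. t y \<in> {-1..1}"
proof -
  have eq: "complex_of_real (t y) =
      of_real (cos (pi * a) / 2) * wave 0 y
      + ((- (1/4) * cis (- (pi * a))) * wave 1 y + (- (1/4) * cis (pi * a)) * wave (-1) y)" for y
  proof -
    have "t y = (cos (pi * a) - cos (2 * pi * y - pi * a)) / 2"
      unfolding t_def by (subst sin_times_sin) (simp add: algebra_simps)
    moreover have "complex_of_real (cos (2 * pi * y - pi * a))
        = (cis (2 * pi * y - pi * a) + cis (- (2 * pi * y - pi * a))) / 2"
      using cos_minus[of "2 * pi * y - pi * a"] sin_minus[of "2 * pi * y - pi * a"]
      by (simp only: complex_eq_iff) simp
    ultimately have "complex_of_real (t y)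
        = (of_real (cos (pi * a)) - (cis (2 * pi * y - pi * a) + cis (- (2 * pi * y - pi * a))) / 2) / 2"
      by (simp only: of_real_divide of_real_diff of_real_numeral)
    then show ?thesis
      by (simp add: cis_mult algebra_simps add_divide_distrib)
  qed
  show "(\<lambda>y. complex_of_real (t y)) \<in> trig_polys"
    unfolding eq by (intro trig_polys.intros)
  show "t y > 0 \<longleftrightarrow> y > a" if y: "y \<in> {0..<1}" for y
  proof -
    have pos: "sin (pi * y) > 0" if "y > 0"
      using y that by (intro sin_gt_zero) auto
    consider "y > a" | "y = a" | "y < a" by linarith
    then show ?thesis
    proof cases
      case 1
      then have "sin (pi * (y - a)) > 0"
        using y a mult_strict_left_mono[of "y - a" 1 pi] by (intro sin_gt_zero) auto
      then show ?thesis using 1 pos a by (simp add: t_def)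
    next
      case 2
      then show ?thesis by (simp add: t_def)
    next
      case 3
      then have "sin (pi * (a - y)) > 0"
        using y a mult_strict_left_mono[of "a - y" 1 pi] by (intro sin_gt_zero) auto
      then have "sin (pi * (y - a)) < 0"
        using sin_minus[of "pi * (a - y)"] by (simp add: algebra_simps)
      moreover have "sin (pi * y) \<ge> 0" using y pos by (cases "y = 0") auto
      ultimately have "t y \<le> 0" by (simp add: t_def mult_nonpos_nonneg)
      then show ?thesis using 3 by simp
    qed
  qed
  show "t y \<in> {-1..1}" for y
  proof -
    have "\<bar>t y\<bar> \<le> 1 * 1" unfolding t_def abs_mult by (intro mult_mono) auto
    then show ?thesis by auto
  qed
qed

lemma trig_polys_space: "sets M = sets borel \<Longrightarrow> measurable_function_space M trig_polys"
  by unfold_locales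
    (auto intro: trig_polys_const trig_polys.sum trig_polys_scale
      simp: trig_polys_measurable cong: measurable_cong_sets)

text \<open>The half-lines \<open>(a, \<infinity>)\<close> generate the Borel sets, and the measure sees only their traces on
  \<open>[0,1)\<close>. Working with an arbitrary finite measure instead of Lebesgue measure allows the theorem
  to be applied to image measures.\<close>
theorem trig_polys_dense:
  fixes \<mu> :: "real measure"
  assumes fin: "finite_measure \<mu>" and sets[measurable_cong]: "sets \<mu> = sets borel"
    and conc: "AE y in \<mu>. y \<in> {0..<1}"
    and f: "f \<in> borel_measurable borel" and L2: "(\<integral>\<^sup>+ x. ennreal ((cmod (f x))\<^sup>2) \<partial>\<mu>) < \<infinity>"
  shows "f \<in> L2_closure \<mu> trig_polys"
proof -
  interpret measurable_function_space \<mu> trig_polys using sets by (rule trig_polys_space)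
  interpret finite_measure \<mu> by (rule fin)
  have space: "space \<mu> = UNIV" using sets_eq_imp_space_eq[OF sets] by simp
  obtain p :: "nat \<Rightarrow> real \<Rightarrow> real" where p: "\<And>n. real_polynomial_function (p n)"
    "\<And>s. s \<in> {-1..1} \<Longrightarrow> (\<lambda>n. p n s) \<longlonglongrightarrow> (if s > 0 then 1 else 0)"
    "\<And>n s. s \<in> {-1..1} \<Longrightarrow> \<bar>p n s\<bar> \<le> 2"
    using polynomials_approximating_positivity by blast
  show ?thesis
  proof (rule dense_from_generator[where G = "range greaterThan"])
    show "sets \<mu> = sigma_sets (space \<mu>) (range greaterThan)"
    proof -
      have "(\<lambda>a::real. {x. eucl_less a x}) = greaterThan"
        by (auto simp: eucl_less_def)
      then show ?thesis
        unfolding sets space using sets_measure_of[of "range greaterThan" "UNIV :: real set"]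
        by (metis borel_eq_greaterThan subset_UNIV Pow_UNIV)
    qed
    show "Int_stable (range (greaterThan :: real \<Rightarrow> _))"
      unfolding Int_stable_def
    proof safe
      fix a b :: real
      have "{a<..} \<inter> {b<..} = {max a b<..}" by auto
      then show "{a<..} \<inter> {b<..} \<in> range greaterThan" by blast
    qed
    show one: "(\<lambda>x. 1) \<in> L2_closure \<mu> trig_polys"
      by (intro subset_closure trig_polys_const)
    show "f \<in> borel_measurable \<mu>" using f by measurable
    fix A :: "real set" assume "A \<in> range greaterThan"
    then obtain a where A: "A = {a<..}" by auto
    consider "a < 0" | "0 \<le> a" "a < 1" | "a \<ge> 1" by linarith
    then show "(\<lambda>x. indicator A x) \<in> L2_closure \<mu> trig_polys"
    proof cases
      case 1
      show ?thesis
        by (rule closure_cong_AE[OF one]) (use 1 conc in \<open>auto simp: A elim!: eventually_mono\<close>)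
    next
      case 3
      show ?thesis
      proof (rule closure_cong_AE[OF subset_closure[OF zero]])
        show "AE y in \<mu>. 0 = indicator A y"
          using conc by eventually_elim (use 3 in \<open>auto simp: A\<close>)
      qed (simp add: A)
    next
      case 2
      define t where "t y = sin (pi * (y - a)) * sin (pi * y)" for y
      note t = trig_poly_positive_iff[OF 2, folded t_def]
      show ?thesis
      proof (rule closure_limit[where F = "\<lambda>n y. complex_of_real (p n (t y))" and w = "\<lambda>_. 2"])
        show "(\<lambda>y. complex_of_real (p n (t y))) \<in> L2_closure \<mu> trig_polys" for n
          using real_polynomial_of_trig_poly[of "p n" t] p(1) t(1) by (blast intro: subset_closure)
        show "(\<lambda>x. indicator A x :: complex) \<in> borel_measurable \<mu>" unfolding A by measurable
        show "AE y in \<mu>. (\<lambda>n. complex_of_real (p n (t y))) \<longlonglongrightarrow> indicator A y"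
          using conc
        proof eventually_elim
          case (elim y)
          have "(\<lambda>n. p n (t y)) \<longlonglongrightarrow> indicator A y"
            using p(2)[OF t(3)[of y]] t(2)[OF elim] by (simp add: A indicator_def of_bool_def)
          then have "(\<lambda>n. complex_of_real (p n (t y))) \<longlonglongrightarrow> of_real (indicator A y)"
            by (rule tendsto_of_real)
          then show ?case by (simp add: indicator_def of_bool_def split: if_splits)
        qed
        show "AE y in \<mu>. cmod (complex_of_real (p n (t y))) \<le> 2" for n
          using p(3)[OF t(3)] by (intro AE_I2) simp
      qed (auto simp flip: less_top simp: ennreal_mult_eq_top_iff)
    qed
  qed (use space fin L2 in auto)
qed

text \<open>Let \<open>\<theta>(x)\<close> be the fractional part of \<open>x/T\<close>. It is almost injective on \<open>K\<close> by the packing condition,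
  so \<open>f\<close> factors almost everywhere on \<open>K\<close> as \<open>h \<circ> \<theta>\<close>. The approximation of \<open>h\<close> by
  trigonometric polynomials with respect to the image measure of \<open>K\<close> under \<open>\<theta>\<close> pulls back to an
  approximation of \<open>f\<close>, because \<open>wave k (\<theta> x) = wave k (x / T)\<close>.\<close>
theorem exponentials_dense_on_packing_set:
  fixes K :: "real set"
  assumes T: "T > 0" and K[measurable]: "K \<in> sets borel" and bdd: "bounded K"
    and pack: "AE x in lborel. x \<in> K \<longrightarrow> (\<forall>m::int. m \<noteq> 0 \<longrightarrow> x + of_int m * T \<notin> K)"
    and f: "square_integrable lborel f" and supp: "\<And>x. x \<notin> K \<Longrightarrow> f x = 0" and \<delta>: "\<delta> > 0"
  shows "\<exists>J c. finite J \<and>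
    sq_dist lborel f (\<lambda>x. \<Sum>k\<in>J. c k * (indicator K x * wave k (x / T))) \<le> ennreal \<delta>"
proof -
  note [measurable] = square_integrable_measurable[OF f]
  define M where "M = density lborel (indicator K)"
  define \<theta> where "\<theta> = (\<lambda>x::real. frac (x / T))"
  have [measurable]: "\<theta> \<in> borel_measurable borel"
    unfolding \<theta>_def frac_def by measurable
  have sets_M[measurable_cong]: "sets M = sets borel" by (simp add: M_def)
  define \<mu> where "\<mu> = distr M borel \<theta>"
  have nnM: "(\<integral>\<^sup>+ x. F x \<partial>M) = (\<integral>\<^sup>+ x. indicator K x * F x \<partial>lborel)"
    if [measurable]: "F \<in> borel_measurable borel" for F
    unfolding M_def by (simp add: nn_integral_density)
  have nn\<mu>: "(\<integral>\<^sup>+ x. F x \<partial>\<mu>) = (\<integral>\<^sup>+ x. indicator K x * F (\<theta> x) \<partial>lborel)"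
    if [measurable]: "F \<in> borel_measurable borel" for F
    unfolding \<mu>_def by (simp add: nn_integral_distr nnM)
  have fin: "finite_measure \<mu>"
  proof (rule finite_measureI)
    have "emeasure \<mu> (space \<mu>) = (\<integral>\<^sup>+ x. 1 \<partial>\<mu>)" by simp
    also have "\<dots> = emeasure lborel K" by (subst nn\<mu>) auto
    finally show "emeasure \<mu> (space \<mu>) \<noteq> \<infinity>"
      using emeasure_bounded_finite[OF bdd] by (simp add: less_top)
  qed
  obtain R where R: "\<And>x. x \<in> K \<Longrightarrow> \<bar>x\<bar> \<le> R"
    using bdd by (auto simp: bounded_iff)
  \<comment> \<open>Boundedness of \<open>K\<close> leaves only finitely many translates to search, so \<open>h\<close> is a finite sum.\<close>
  define B where "B = \<lceil>R / T\<rceil> + 1"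
  define h where "h = (\<lambda>y. \<Sum>k\<in>{-B..B}. f (T * (y + of_int k)) * indicator K (T * (y + of_int k)))"
  have [measurable]: "h \<in> borel_measurable borel" unfolding h_def by measurable
  have h: "AE x in lborel. x \<in> K \<longrightarrow> h (\<theta> x) = f x"
    using pack
  proof eventually_elim
    case (elim x)
    show ?case
    proof
      assume x: "x \<in> K"
      define m where "m = \<lfloor>x / T\<rfloor>"
      have eq: "T * (\<theta> x + of_int k) = x + of_int (k - m) * T" for k
        using T by (simp add: \<theta>_def frac_def m_def algebra_simps)
      have "\<bar>x / T\<bar> \<le> R / T" using R[OF x] T by (simp add: divide_right_mono)
      then have "- (R / T) \<le> x / T" "x / T \<le> R / T" by linarith+
      moreover have "of_int m \<le> x / T" "x / T < of_int m + 1" "R / T \<le> of_int \<lceil>R / T\<rceil>"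
        unfolding m_def by linarith+
      ultimately have "real_of_int m \<le> of_int B" "real_of_int (- B) < of_int (m + 1)"
        unfolding B_def of_int_add of_int_minus of_int_1 by linarith+
      then have m: "m \<in> {-B..B}" unfolding of_int_le_iff of_int_less_iff by simp
      have "h (\<theta> x) = (\<Sum>k\<in>{-B..B}. if k = m then f x else 0)"
        unfolding h_def eq
      proof (intro sum.cong refl)
        fix k
        show "f (x + of_int (k - m) * T) * indicator K (x + of_int (k - m) * T) = (if k = m then f x else 0)"
          using elim x by (cases "k = m") (auto simp: indicator_def dest!: spec[of _ "k - m"])
      qed
      then show "h (\<theta> x) = f x" using m by simp
    qed
  qed
  have L2: "(\<integral>\<^sup>+ y. ennreal ((cmod (h y))\<^sup>2) \<partial>\<mu>) < \<infinity>"
  proof -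
    have "(\<integral>\<^sup>+ y. ennreal ((cmod (h y))\<^sup>2) \<partial>\<mu>) = (\<integral>\<^sup>+ x. indicator K x * ennreal ((cmod (h (\<theta> x)))\<^sup>2) \<partial>lborel)"
      by (subst nn\<mu>) auto
    also have "\<dots> \<le> (\<integral>\<^sup>+ x. ennreal ((cmod (f x))\<^sup>2) \<partial>lborel)"
      using h by (intro nn_integral_mono_AE) (auto elim!: eventually_mono split: split_indicator)
    also have "\<dots> < \<infinity>" using f by (simp add: square_integrable_iff_finite)
    finally show ?thesis .
  qed
  have conc: "AE y in \<mu>. y \<in> {0..<1}"
  proof -
    have "\<theta> x \<in> {0..<1}" for x by (simp add: \<theta>_def frac_lt_1)
    then show ?thesis unfolding \<mu>_def by (subst AE_distr_iff) auto
  qed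
  have "h \<in> L2_closure \<mu> trig_polys"
    by (rule trig_polys_dense[OF fin _ conc _ L2]) (auto simp: \<mu>_def)
  then obtain p where p: "p \<in> trig_polys" "sq_dist \<mu> h p \<le> ennreal \<delta>"
    using \<delta> unfolding L2_closure_def by blast
  note [measurable] = trig_polys_measurable[OF p(1)]
  obtain J c where J: "finite J" "p = (\<lambda>x. \<Sum>k\<in>J. c k * wave k x)"
    using trig_polys_finite_span[OF p(1)] unfolding finite_span_def by blast
  have wave: "wave k (\<theta> x) = wave k (x / T)" for k x
  proof -
    have "wave k (\<theta> x) = wave k (x / T) * cis (2 * pi * of_int (- k * \<lfloor>x / T\<rfloor>))"
      unfolding \<theta>_def frac_def cis_mult by (simp add: algebra_simps)
    moreover have "cis (2 * pi * of_int (- k * \<lfloor>x / T\<rfloor>)) = 1"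
      by (rule cis_multiple_2pi) simp
    ultimately show ?thesis by simp
  qed
  have "sq_dist lborel f (\<lambda>x. \<Sum>k\<in>J. c k * (indicator K x * wave k (x / T)))
      = (\<integral>\<^sup>+ x. indicator K x * ennreal ((cmod (h (\<theta> x) - p (\<theta> x)))\<^sup>2) \<partial>lborel)"
    unfolding sq_dist_def
  proof (rule nn_integral_cong_AE, use h in eventually_elim)
    case (elim x)
    show ?case
      using elim supp[of x] by (cases "x \<in> K") (auto simp: J wave)
  qed
  also have "\<dots> = sq_dist \<mu> h p"
    unfolding sq_dist_def by (subst nn\<mu>) auto
  finally have eq: "sq_dist lborel f (\<lambda>x. \<Sum>k\<in>J. c k * (indicator K x * wave k (x / T)))
    = sq_dist \<mu> h p" .
  show ?thesis using J(1) p(2) unfolding eq[symmetric] by blast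
qed

section \<open>Integration over sets that tile by translations\<close>
text \<open>Cutting the line into the intervals \<open>[k T, (k+1) T)\<close> and moving each of them back to \<open>[0, T)\<close>.
  The integers are enumerated by \<open>int_decode\<close> to obtain an ordinary series.\<close>
lemma nn_integral_unfold_translates:
  fixes F :: "real \<Rightarrow> ennreal"
  assumes T: "T > 0" and F[measurable]: "F \<in> borel_measurable borel"
  shows "(\<integral>\<^sup>+ x. F x \<partial>lborel)
    = (\<integral>\<^sup>+ x. indicator {0..<T} x * (\<Sum>i. F (x + of_int (int_decode i) * T)) \<partial>lborel)"
proof -
  let ?q = "\<lambda>i. of_int (int_decode i) :: real"
  let ?I = "\<lambda>i. {?q i * T..<(?q i + 1) * T}"
  have split: "F x = (\<Sum>i. indicator (?I i) x * F x)" for x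
  proof -
    define i0 where "i0 = int_encode \<lfloor>x / T\<rfloor>"
    have *: "x \<in> ?I i \<longleftrightarrow> i = i0" for i
    proof -
      have "x \<in> ?I i \<longleftrightarrow> ?q i \<le> x / T \<and> x / T < ?q i + 1"
        using T by (simp add: field_simps)
      also have "\<dots> \<longleftrightarrow> int_decode i = \<lfloor>x / T\<rfloor>"
        by (subst eq_commute[of _ "\<lfloor>x / T\<rfloor>"]) (simp add: floor_eq_iff)
      also have "\<dots> \<longleftrightarrow> i = i0" unfolding i0_def by (metis int_decode_inverse int_encode_inverse)
      finally show ?thesis .
    qed
    have "(\<Sum>i. indicator (?I i) x * F x) = (\<Sum>i\<in>{i0}. indicator (?I i) x * F x)"
      by (rule suminf_finite) (simp_all add: * indicator_def del: atLeastLessThan_iff)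
    then show ?thesis by (simp add: * del: atLeastLessThan_iff)
  qed
  have "(\<integral>\<^sup>+ x. F x \<partial>lborel) = (\<integral>\<^sup>+ x. (\<Sum>i. indicator (?I i) x * F x) \<partial>lborel)"
    using split by simp
  also have "\<dots> = (\<Sum>i. \<integral>\<^sup>+ x. indicator (?I i) x * F x \<partial>lborel)"
    by (rule nn_integral_suminf) measurable
  also have "\<dots> = (\<Sum>i. \<integral>\<^sup>+ x. indicator {0..<T} x * F (x + ?q i * T) \<partial>lborel)"
  proof (rule suminf_cong)
    fix i
    have "(\<integral>\<^sup>+ x. indicator (?I i) x * F x \<partial>lborel)
      = (\<integral>\<^sup>+ x. indicator (?I i) (?q i * T + x) * F (?q i * T + x) \<partial>lborel)"
      using nn_integral_real_affine[of "\<lambda>x. indicator (?I i) x * F x" 1 "?q i * T"] by simp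
    also have "\<dots> = (\<integral>\<^sup>+ x. indicator {0..<T} x * F (x + ?q i * T) \<partial>lborel)"
      by (intro nn_integral_cong) (auto simp: indicator_def algebra_simps)
    finally show "(\<integral>\<^sup>+ x. indicator (?I i) x * F x \<partial>lborel)
      = (\<integral>\<^sup>+ x. indicator {0..<T} x * F (x + ?q i * T) \<partial>lborel)" .
  qed
  also have "\<dots> = (\<integral>\<^sup>+ x. (\<Sum>i. indicator {0..<T} x * F (x + ?q i * T)) \<partial>lborel)"
    by (rule nn_integral_suminf[symmetric]) measurable
  finally show ?thesis by simp
qed

definition translation_tile :: "real \<Rightarrow> real set \<Rightarrow> bool" where
  "translation_tile T K \<longleftrightarrow> (AE x in lborel. \<exists>!m::int. x + of_int m * T \<in> K)"

text \<open>After unfolding, the translates of the indicator of \<open>K\<close> sum to \<open>1\<close> almost everywhere.\<close>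
lemma nn_integral_tile:
  assumes T: "T > 0" and K[measurable]: "K \<in> sets borel" and tile: "translation_tile T K"
    and F[measurable]: "F \<in> borel_measurable borel"
    and per: "\<And>x m. F (x + of_int m * T) = F x"
  shows "(\<integral>\<^sup>+ x. indicator K x * F x \<partial>lborel) = (\<integral>\<^sup>+ x. indicator {0..<T} x * F x \<partial>lborel)"
proof -
  have "(\<integral>\<^sup>+ x. indicator K x * F x \<partial>lborel)
    = (\<integral>\<^sup>+ x. indicator {0..<T} x * (\<Sum>i. indicator K (x + of_int (int_decode i) * T) * F x) \<partial>lborel)"
    by (subst nn_integral_unfold_translates[OF T]) (auto simp: per)
  also have "\<dots> = (\<integral>\<^sup>+ x. indicator {0..<T} x * F x \<partial>lborel)"
  proof (rule nn_integral_cong_AE, use tile[unfolded translation_tile_def] in eventually_elim)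
    case (elim x)
    then obtain m :: int where m: "\<And>k. x + of_int k * T \<in> K \<longleftrightarrow> k = m" by metis
    have "(\<Sum>i. indicator K (x + of_int (int_decode i) * T) * F x)
      = (\<Sum>i\<in>{int_encode m}. indicator K (x + of_int (int_decode i) * T) * F x)"
      by (rule suminf_finite) (auto simp: m indicator_def)
    also have "\<dots> = F x" by (simp add: m)
    finally show ?case by simp
  qed
  finally show ?thesis .
qed

text \<open>Adding \<open>1\<close> makes the integrand nonnegative, so that \<open>nn_integral_tile\<close> can transport the integral
  from one period to an arbitrary tile.\<close>
lemma nn_integral_wave_period:
  assumes "g = cos \<or> g = sin" "k \<noteq> 0" and T: "T > 0"
  shows "(\<integral>\<^sup>+ x. indicator {0..<T} x * ennreal (1 + g (2 * pi * of_int k * (x / T))) \<partial>lborel) = ennreal T"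
proof -
  have nonneg: "0 \<le> 1 + g y" for y :: real
  proof -
    have "\<bar>g y\<bar> \<le> 1" using assms(1) by auto
    then show ?thesis by linarith
  qed
  define a where "a = 2 * pi * of_int k / T"
  have a: "a \<noteq> 0" using assms by (simp add: a_def)
  have aT: "a * T = 2 * pi * of_int k" using T by (simp add: a_def)
  have ga: "2 * pi * of_int k * (x / T) = a * x" for x by (simp add: a_def)
  obtain G where G: "\<And>x. ((\<lambda>x. x + G (a * x) / a) has_real_derivative 1 + g (a * x)) (at x)"
    and GT: "G (a * T) = G 0"
  proof (cases "g = cos")
    case True
    show ?thesis
    proof (rule that[of sin])
      show "sin (a * T) = sin 0" unfolding aT
        using sin_int_2pin[of k] by (simp add: mult_ac)
    qed (use True a in \<open>auto intro!: derivative_eq_intros\<close>)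
  next
    case False
    with assms(1) have g: "g = sin" by simp
    show ?thesis
    proof (rule that[of "\<lambda>x. - cos x"])
      show "- cos (a * T) = - cos 0" unfolding aT
        using cos_int_2pin[of k] by (simp add: mult_ac)
    qed (use g a in \<open>auto intro!: derivative_eq_intros\<close>)
  qed
  have "(\<integral>\<^sup>+ x. indicator {0..<T} x * ennreal (1 + g (2 * pi * of_int k * (x / T))) \<partial>lborel)
    = (\<integral>\<^sup>+ x. ennreal (1 + g (a * x)) * indicator {0..T} x \<partial>lborel)"
    unfolding ga
    by (intro nn_integral_cong_AE, use AE_lborel_singleton[of T] in eventually_elim)
      (auto simp: indicator_def)
  also have "\<dots> = ennreal ((T + G (a * T) / a) - (0 + G (a * 0) / a))"
  proof (rule nn_integral_FTC_Icc)
    show "(\<lambda>x. 1 + g (a * x)) \<in> borel_measurable borel" using assms(1) by auto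
    show "((\<lambda>x. x + G (a * x) / a) has_real_derivative 1 + g (a * x)) (at x)" for x
      by (rule G)
  qed (use nonneg T in auto)
  finally show ?thesis by (simp add: GT)
qed

lemma emeasure_tile:
  assumes "T > 0" "K \<in> sets borel" "translation_tile T K"
  shows "emeasure lborel K = ennreal T"
  using nn_integral_tile[OF assms, of "\<lambda>_. 1"] assms by simp

lemma square_integrable_wave:
  assumes "K \<in> sets borel" "emeasure lborel K < \<infinity>"
  shows "square_integrable lborel (\<lambda>x. c * (indicator K x * wave k (x / T)))"
proof (rule square_integrable_scale)
  have "(cmod (indicator K x * wave k (x / T)))\<^sup>2 = indicator K x" for x
    by (simp add: norm_mult indicator_def)
  then show "square_integrable lborel (\<lambda>x. indicator K x * wave k (x / T))"
    using assms by (simp add: square_integrable_def)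
qed

text \<open>Real and imaginary part are handled separately: \<open>1 + cos\<close> and \<open>1 + sin\<close> have integral \<open>T\<close> over the
  tile, just as over one period, and the tile itself has measure \<open>T\<close>.\<close>
lemma integral_wave_tile:
  assumes T: "T > 0" and K[measurable]: "K \<in> sets borel" and tile: "translation_tile T K"
  shows "(LINT x|lborel. indicator K x * wave k (x / T)) = (if k = 0 then of_real T else 0)"
proof -
  have fin: "emeasure lborel K = ennreal T" by (rule emeasure_tile[OF assms])
  have int_K: "integrable lborel (indicator K :: real \<Rightarrow> real)"
    using fin by simp
  show ?thesis
  proof (cases "k = 0")
    case True
    have "(LINT x|lborel. indicator K x :: complex) = of_real (measure lborel K)"
    proof -
      have "(LINT x|lborel. indicator K x :: complex) = (LINT x|lborel. complex_of_real (indicator K x))"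
        by (intro Bochner_Integration.integral_cong) (auto simp: indicator_def)
      then show ?thesis by simp
    qed
    then show ?thesis using True fin T by (simp add: measure_def)
  next
    case False
    have *: "(LINT x|lborel. indicator K x * g (2 * pi * of_int k * (x / T))) = 0"
      and int: "integrable lborel (\<lambda>x. indicator K x * g (2 * pi * of_int k * (x / T)))"
      if g: "g = cos \<or> g = sin" for g :: "real \<Rightarrow> real"
    proof -
      let ?g = "\<lambda>x. g (2 * pi * of_int k * (x / T))"
      have [measurable]: "?g \<in> borel_measurable borel" using g by auto
      have bnd: "\<bar>?g x\<bar> \<le> 1" for x using g by auto
      have nonneg: "0 \<le> 1 + ?g x" for x using bnd[of x] by linarith
      show int: "integrable lborel (\<lambda>x. indicator K x * ?g x)"
        by (rule Bochner_Integration.integrable_bound[OF int_K])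
          (use bnd in \<open>auto simp: abs_mult intro: mult_left_le simp del: times_divide_eq_right\<close>)
      have per: "?g (x + of_int m * T) = ?g x" for x m
      proof -
        have "2 * pi * of_int k * ((x + of_int m * T) / T)
            = 2 * pi * of_int k * (x / T) + 2 * pi * of_int (k * m)"
          using T by (simp add: field_simps)
        moreover have "sin (y + 2 * pi * of_int l) = sin y" "cos (y + 2 * pi * of_int l) = cos y" for y l
          using sin_int_2pin[of l] cos_int_2pin[of l] by (simp_all add: sin_add cos_add mult_ac)
        ultimately show ?thesis using g by (elim disjE) (simp_all only:)
      qed
      have "(\<integral>\<^sup>+ x. ennreal (indicator K x * (1 + ?g x)) \<partial>lborel)
          = (\<integral>\<^sup>+ x. indicator K x * ennreal (1 + ?g x) \<partial>lborel)"
        by (intro nn_integral_cong) (auto simp: indicator_def)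
      also have "\<dots> = (\<integral>\<^sup>+ x. indicator {0..<T} x * ennreal (1 + ?g x) \<partial>lborel)"
        by (rule nn_integral_tile[OF T K tile]) (measurable, simp only: per)
      also have "\<dots> = ennreal T" by (rule nn_integral_wave_period[OF g False T])
      finally have "(LINT x|lborel. indicator K x * (1 + ?g x)) = T"
        by (subst integral_eq_nn_integral) (measurable, use T nonneg in simp_all)
      moreover have "(LINT x|lborel. indicator K x * (1 + ?g x))
          = (LINT x|lborel. indicator K x) + (LINT x|lborel. indicator K x * ?g x)"
        unfolding distrib_left mult_1_right by (rule Bochner_Integration.integral_add[OF int_K int])
      moreover have "(LINT x|lborel. indicator K x) = T"
        using fin T by (simp add: measure_def)
      ultimately show "(LINT x|lborel. indicator K x * ?g x) = 0" by simp
    qed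
    have "(LINT x|lborel. indicator K x * wave k (x / T))
      = (LINT x|lborel. complex_of_real (indicator K x * cos (2 * pi * of_int k * (x / T)))
          + \<i> * complex_of_real (indicator K x * sin (2 * pi * of_int k * (x / T))))"
      by (intro Bochner_Integration.integral_cong) (auto simp: indicator_def complex_eq_iff)
    also have "\<dots> = of_real (LINT x|lborel. indicator K x * cos (2 * pi * of_int k * (x / T)))
          + \<i> * of_real (LINT x|lborel. indicator K x * sin (2 * pi * of_int k * (x / T)))"
      using int[of cos] int[of sin] by (subst Bochner_Integration.integral_add)
        (auto simp del: of_real_mult intro!: integrable_mult_right)
    finally show ?thesis using *[of cos] *[of sin] False by simp
  qed
qed

section \<open>Plancherel's theorem for compact support\<close>
definition fourier :: "(real \<Rightarrow> complex) \<Rightarrow> real \<Rightarrow> complex" where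
  "fourier f \<xi> = (LINT x|lborel. f x * cis (- 2 * pi * x * \<xi>))"

lemma integrable_compact_support:
  fixes f :: "real \<Rightarrow> complex"
  assumes f: "square_integrable lborel f" and supp: "\<And>x. x \<notin> {-R..R} \<Longrightarrow> f x = 0"
  shows "integrable lborel f"
proof -
  have "square_integrable lborel (\<lambda>x. indicator {-R..R} x * wave 0 (x / 1))"
    using square_integrable_wave[of "{-R..R}" 1 0 1] emeasure_bounded_finite[of "{-R..R}"] by simp
  from integrable_product[OF f this]
  have "integrable lborel (\<lambda>x. f x * cnj (indicator {-R..R} x))" by simp
  moreover have "f x * cnj (indicator {-R..R} x) = f x" for x
    using supp[of x] by (auto simp: indicator_def)
  ultimately show ?thesis by simp
qed

lemma fourier_measurable [measurable]:
  assumes [measurable]: "f \<in> borel_measurable borel"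
  shows "fourier f \<in> borel_measurable borel"
  unfolding fourier_def[abs_def]
  by (intro lborel.borel_measurable_lebesgue_integral) measurable

lemma translation_tile_interval:
  fixes T a :: real
  assumes "T > 0" shows "translation_tile T {a..<a + T}"
  unfolding translation_tile_def
proof (rule AE_I2)
  fix x :: real
  have "x + of_int m * T \<in> {a..<a + T} \<longleftrightarrow> m = - \<lfloor>(x - a) / T\<rfloor>" for m :: int
  proof -
    have "x + of_int m * T \<in> {a..<a + T} \<longleftrightarrow> of_int (- m) \<le> (x - a) / T \<and> (x - a) / T < of_int (- m) + 1"
      using assms by (simp add: field_simps)
    also have "\<dots> \<longleftrightarrow> \<lfloor>(x - a) / T\<rfloor> = - m" by (auto simp: floor_eq_iff)
    finally show ?thesis by auto
  qed
  then show "\<exists>!m::int. x + of_int m * T \<in> {a..<a + T}" by auto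
qed

lemma tile_imp_packing:
  assumes "translation_tile T K"
  shows "AE x in lborel. x \<in> K \<longrightarrow> (\<forall>m::int. m \<noteq> 0 \<longrightarrow> x + of_int m * T \<notin> K)"
  using assms unfolding translation_tile_def
proof eventually_elim
  case (elim x)
  then obtain m :: int where m: "\<And>k. x + of_int k * T \<in> K \<longleftrightarrow> k = m" by metis
  show ?case
    using m[of 0] by (auto simp: m)
qed

lemma inner_prod_waves_tile:
  assumes T: "T > 0" and K: "K \<in> sets borel" and tile: "translation_tile T K"
  shows "inner_prod lborel (\<lambda>x. of_real (1 / sqrt T) * (indicator K x * wave k (x / T)))
      (\<lambda>x. of_real (1 / sqrt T) * (indicator K x * wave l (x / T))) = (if k = l then 1 else 0)"
proof -
  have "inner_prod lborel (\<lambda>x. of_real (1 / sqrt T) * (indicator K x * wave k (x / T)))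
      (\<lambda>x. of_real (1 / sqrt T) * (indicator K x * wave l (x / T)))
    = (LINT x|lborel. of_real (1 / T) * (indicator K x * wave (k - l) (x / T)))"
    unfolding inner_prod_def
  proof (intro Bochner_Integration.integral_cong refl)
    fix x
    have "cnj (wave l (x / T)) = wave (- l) (x / T)" by (simp add: cis_cnj)
    moreover have "wave k (x / T) * wave (- l) (x / T) = wave (k - l) (x / T)"
      by (simp add: cis_mult algebra_simps diff_divide_distrib)
    moreover have "complex_of_real (1 / sqrt T) * of_real (1 / sqrt T) = of_real (1 / T)"
      using T by (simp flip: of_real_mult)
    ultimately show "of_real (1 / sqrt T) * (indicator K x * wave k (x / T)) *
        cnj (of_real (1 / sqrt T) * (indicator K x * wave l (x / T)))
      = of_real (1 / T) * (indicator K x * wave (k - l) (x / T))"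
      by (cases "x \<in> K") (simp_all add: mult_ac)
  qed
  also have "\<dots> = (if k = l then 1 else 0)"
    using T by (simp only: Bochner_Integration.integral_mult_right_zero integral_wave_tile[OF assms]) auto
  finally show ?thesis .
qed

text \<open>Parseval's identity on an interval of length \<open>T\<close> containing the support, applied to
  \<open>f(x) exp(-2\<pi>i x s)\<close> and integrated over \<open>0 \<le> s < 1/T\<close>.\<close>
theorem Plancherel_compact_support:
  assumes f: "square_integrable lborel f" and supp: "\<And>x. x \<notin> {-R..R} \<Longrightarrow> f x = 0"
  shows "square_integrable lborel (fourier f)" and "sq_norm lborel (fourier f) = sq_norm lborel f"
proof -
  note [measurable] = square_integrable_measurable[OF f]
  define T where "T = 2 * \<bar>R\<bar> + 1"
  have T: "T > 0" by (simp add: T_def)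
  let ?K = "{- (T/2)..<- (T/2) + T}"
  have supp_K: "f x = 0" if "x \<notin> ?K" for x
  proof (rule supp, rule notI)
    assume "x \<in> {-R..R}"
    then have "\<bar>x\<bar> \<le> \<bar>R\<bar>" by auto
    then have "\<bar>x\<bar> < T / 2" by (simp add: T_def)
    with that show False by (auto simp: abs_less_iff)
  qed
  have tile: "translation_tile T ?K" by (rule translation_tile_interval[OF T])
  have fin: "emeasure lborel ?K < \<infinity>" using T by simp
  define u where "u = (\<lambda>k x. of_real (1 / sqrt T) * (indicator ?K x * wave k (x / T)) :: complex)"
  have u: "square_integrable lborel (u k)" for k
    unfolding u_def by (rule square_integrable_wave) (use fin in auto)
  have coeff: "ennreal ((cmod (fourier f (s + of_int k * (1 / T))))\<^sup>2)
      = ennreal T * ennreal ((cmod (inner_prod lborel (\<lambda>x. f x * cis (- 2 * pi * x * s)) (u k)))\<^sup>2)" for s k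
  proof -
    have "inner_prod lborel (\<lambda>x. f x * cis (- 2 * pi * x * s)) (u k)
      = (LINT x|lborel. of_real (1 / sqrt T) * (f x * cis (- 2 * pi * x * (s + of_int k * (1 / T)))))"
      unfolding inner_prod_def
    proof (intro Bochner_Integration.integral_cong refl)
      fix x
      have "cnj (wave k (x / T)) = cis (- 2 * pi * of_int k * (x / T))" by (simp add: cis_cnj)
      moreover have "cis (- 2 * pi * x * s) * cis (- 2 * pi * of_int k * (x / T))
          = cis (- 2 * pi * x * (s + of_int k * (1 / T)))"
        by (simp add: cis_mult algebra_simps)
      ultimately show "f x * cis (- 2 * pi * x * s) * cnj (u k x)
        = of_real (1 / sqrt T) * (f x * cis (- 2 * pi * x * (s + of_int k * (1 / T))))"
        using supp_K[of x] by (cases "x \<in> ?K") (simp_all add: u_def mult_ac)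
    qed
    also have "\<dots> = of_real (1 / sqrt T) * fourier f (s + of_int k * (1 / T))"
      unfolding fourier_def by simp
    finally have "(cmod (inner_prod lborel (\<lambda>x. f x * cis (- 2 * pi * x * s)) (u k)))\<^sup>2
        = (1 / T) * (cmod (fourier f (s + of_int k * (1 / T))))\<^sup>2"
      using T by (simp add: norm_mult norm_divide power_mult_distrib power_divide)
    then have "(cmod (fourier f (s + of_int k * (1 / T))))\<^sup>2
        = T * (cmod (inner_prod lborel (\<lambda>x. f x * cis (- 2 * pi * x * s)) (u k)))\<^sup>2"
      using T by simp
    then show ?thesis using T by (simp add: ennreal_mult)
  qed
  have sum: "(\<Sum>i. ennreal ((cmod (fourier f (s + of_int (int_decode i) * (1 / T))))\<^sup>2))
      = ennreal T * ennreal (sq_norm lborel f)" for s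
  proof -
    let ?g = "\<lambda>x. f x * cis (- 2 * pi * x * s)"
    have g: "square_integrable lborel ?g"
      using f by (simp add: square_integrable_def norm_mult)
    have "(\<Sum>i. ennreal ((cmod (inner_prod lborel ?g (u (int_decode i))))\<^sup>2)) = ennreal (sq_norm lborel ?g)"
    proof (rule Parseval[OF g u])
      show "inner_prod lborel (u i) (u j) = (if i = j then 1 else 0)" for i j
        unfolding u_def by (rule inner_prod_waves_tile[OF T _ tile]) simp
      show "bij int_decode" by (rule bij_int_decode)
      fix \<delta> :: real assume \<delta>: "\<delta> > 0"
      have "\<exists>J c. finite J \<and>
        sq_dist lborel ?g (\<lambda>x. \<Sum>k\<in>J. c k * (indicator ?K x * wave k (x / T))) \<le> ennreal \<delta>"
        by (rule exponentials_dense_on_packing_set[OF T _ _ tile_imp_packing[OF tile] g _ \<delta>])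
          (use supp_K in \<open>auto intro: bounded_subset[OF bounded_closed_interval[of "-(T/2)" "-(T/2)+T"]]\<close>)
      then obtain J c where J: "finite J"
        "sq_dist lborel ?g (\<lambda>x. \<Sum>k\<in>J. c k * (indicator ?K x * wave k (x / T))) \<le> ennreal \<delta>" by blast
      have "c k * (indicator ?K x * wave k (x / T)) = (c k * of_real (sqrt T)) * u k x" for k x
        using T by (simp add: u_def field_simps)
      then have "(\<lambda>x. \<Sum>k\<in>J. c k * (indicator ?K x * wave k (x / T)))
          = (\<lambda>x. \<Sum>k\<in>J. (c k * of_real (sqrt T)) * u k x)"
        by (simp only:)
      with J show "\<exists>J c. finite J \<and> sq_dist lborel ?g (\<lambda>x. \<Sum>i\<in>J. c i * u i x) \<le> ennreal \<delta>"
        by (intro exI[of _ J] exI[of _ "\<lambda>k. c k * of_real (sqrt T)"]) (simp only: conj_absorb)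
    qed
    moreover have "sq_norm lborel ?g = sq_norm lborel f" by (simp add: sq_norm_def norm_mult)
    ultimately show ?thesis unfolding coeff by (simp add: ennreal_suminf_cmult)
  qed
  have eq: "(\<integral>\<^sup>+ \<xi>. ennreal ((cmod (fourier f \<xi>))\<^sup>2) \<partial>lborel) = ennreal (sq_norm lborel f)"
  proof -
    have "(\<integral>\<^sup>+ \<xi>. ennreal ((cmod (fourier f \<xi>))\<^sup>2) \<partial>lborel)
      = (\<integral>\<^sup>+ s. indicator {0..<1/T} s * (ennreal T * ennreal (sq_norm lborel f)) \<partial>lborel)"
      using nn_integral_unfold_translates[of "1/T" "\<lambda>\<xi>. ennreal ((cmod (fourier f \<xi>))\<^sup>2)"] T
      unfolding sum by simp
    also have "\<dots> = emeasure lborel {0..<1/T} * (ennreal T * ennreal (sq_norm lborel f))"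
      by (subst nn_integral_multc) auto
    also have "\<dots> = ennreal (1/T) * (ennreal T * ennreal (sq_norm lborel f))"
      using T by simp
    also have "\<dots> = ennreal (sq_norm lborel f)"
      using T by (simp add: mult.assoc[symmetric] flip: ennreal_mult)
    finally show ?thesis .
  qed
  then show si: "square_integrable lborel (fourier f)"
    by (simp add: square_integrable_iff_finite)
  show "sq_norm lborel (fourier f) = sq_norm lborel f"
    using nn_integral_eq_sq_norm[OF si] eq by (simp add: sq_norm_nonneg)
qed

section \<open>The inverse Fourier transform\<close>
definition compactly_supported_L2 :: "(real \<Rightarrow> complex) \<Rightarrow> bool" where
  "compactly_supported_L2 f \<longleftrightarrow>
     square_integrable lborel f \<and> (\<exists>R. \<forall>x. x \<notin> {-R..R} \<longrightarrow> f x = 0)"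

lemma compactly_supported_L2D:
  assumes "compactly_supported_L2 f"
  shows "square_integrable lborel f" "f \<in> borel_measurable borel" "integrable lborel f"
    "square_integrable lborel (fourier f)" "sq_norm lborel (fourier f) = sq_norm lborel f"
proof -
  obtain R where f: "square_integrable lborel f" and R: "\<And>x. x \<notin> {-R..R} \<Longrightarrow> f x = 0"
    using assms unfolding compactly_supported_L2_def by blast
  show "square_integrable lborel f" by (rule f)
  show "f \<in> borel_measurable borel" using square_integrable_measurable[OF f] by simp
  show "integrable lborel f" by (rule integrable_compact_support[OF f R])
  show "square_integrable lborel (fourier f)" "sq_norm lborel (fourier f) = sq_norm lborel f"
    by (rule Plancherel_compact_support[OF f R], assumption)+
qed

lemma compactly_supported_L2_add:
  assumes "compactly_supported_L2 f" "compactly_supported_L2 g"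
  shows "compactly_supported_L2 (\<lambda>x. f x + g x)"
proof -
  obtain R S where *: "\<And>x. x \<notin> {-R..R} \<Longrightarrow> f x = 0" "\<And>x. x \<notin> {-S..S} \<Longrightarrow> g x = 0"
    using assms unfolding compactly_supported_L2_def by blast
  have "f x + g x = 0" if "x \<notin> {- max R S..max R S}" for x
  proof -
    have "x \<notin> {-R..R}" "x \<notin> {-S..S}" using that by (auto simp: max_def split: if_splits)
    then show ?thesis using *(1)[of x] *(2)[of x] by simp
  qed
  then show ?thesis
    using assms unfolding compactly_supported_L2_def by (blast intro: square_integrable_add)
qed

lemma compactly_supported_L2_scale:
  "compactly_supported_L2 f \<Longrightarrow> compactly_supported_L2 (\<lambda>x. c * f x)"
  unfolding compactly_supported_L2_def by (auto intro: square_integrable_scale)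

lemma compactly_supported_L2_sum:
  "finite J \<Longrightarrow> (\<And>i. i \<in> J \<Longrightarrow> compactly_supported_L2 (f i)) \<Longrightarrow>
     compactly_supported_L2 (\<lambda>x. \<Sum>i\<in>J. f i x)"
proof (induction J rule: finite_induct)
  case empty
  show ?case by (simp add: compactly_supported_L2_def square_integrable_def)
next
  case (insert i J)
  then have "compactly_supported_L2 (\<lambda>x. f i x + (\<Sum>i\<in>J. f i x))"
    by (intro compactly_supported_L2_add) auto
  with insert show ?case by simp
qed

lemma integrable_fourier_integrand:
  assumes "integrable lborel f"
  shows "integrable lborel (\<lambda>x. f x * cis (- 2 * pi * x * \<xi>))"
  by (rule Bochner_Integration.integrable_bound[OF assms])
    (use assms in \<open>auto simp: norm_mult intro!: borel_measurable_times cis_measurable\<close>)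

lemma fourier_add:
  assumes "integrable lborel f" "integrable lborel g"
  shows "fourier (\<lambda>x. f x + g x) \<xi> = fourier f \<xi> + fourier g \<xi>"
  unfolding fourier_def distrib_right
  by (rule Bochner_Integration.integral_add) (intro integrable_fourier_integrand assms)+

lemma fourier_scale: "fourier (\<lambda>x. c * f x) \<xi> = c * fourier f \<xi>"
  unfolding fourier_def mult.assoc by simp

definition inverse_fourier :: "(real \<Rightarrow> complex) \<Rightarrow> real \<Rightarrow> complex" where
  "inverse_fourier g x = fourier g (- x)"

lemma inverse_fourier_measurable [measurable]:
  assumes [measurable]: "f \<in> borel_measurable borel"
  shows "inverse_fourier f \<in> borel_measurable borel"
  unfolding inverse_fourier_def[abs_def] by measurable

lemma inverse_fourier_sum:
  assumes "finite J" "\<And>i. i \<in> J \<Longrightarrow> compactly_supported_L2 (g i)"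
  shows "inverse_fourier (\<lambda>x. \<Sum>i\<in>J. c i * g i x) x = (\<Sum>i\<in>J. c i * inverse_fourier (g i) x)"
  using assms
proof (induction J rule: finite_induct)
  case empty
  show ?case by (simp add: inverse_fourier_def fourier_def)
next
  case (insert i J)
  have "compactly_supported_L2 (\<lambda>x. c i * g i x)" "compactly_supported_L2 (\<lambda>x. \<Sum>i\<in>J. c i * g i x)"
    using insert by (auto intro!: compactly_supported_L2_scale compactly_supported_L2_sum)
  then have "inverse_fourier (\<lambda>x. c i * g i x + (\<Sum>i\<in>J. c i * g i x)) x
      = inverse_fourier (\<lambda>x. c i * g i x) x + inverse_fourier (\<lambda>x. \<Sum>i\<in>J. c i * g i x) x"
    unfolding inverse_fourier_def by (intro fourier_add compactly_supported_L2D)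
  then show ?case using insert by (simp add: inverse_fourier_def fourier_scale)
qed

lemma inverse_fourier_square_integrable:
  assumes "compactly_supported_L2 g"
  shows "square_integrable lborel (inverse_fourier g)" "sq_norm lborel (inverse_fourier g) = sq_norm lborel g"
proof -
  note g = compactly_supported_L2D[OF assms]
  have "(\<lambda>x. (cmod (inverse_fourier g x))\<^sup>2) = (\<lambda>x. (cmod (fourier g (0 + (-1) * x)))\<^sup>2)"
    by (simp add: inverse_fourier_def)
  moreover have "integrable lborel (\<lambda>x. (cmod (fourier g (0 + (-1) * x)))\<^sup>2)"
    using g(4) by (subst lborel_integrable_real_affine_iff) (auto simp: square_integrable_def)
  ultimately show "square_integrable lborel (inverse_fourier g)"
    using g(2) by (simp add: square_integrable_def)
  have "sq_norm lborel (fourier g) = sq_norm lborel (inverse_fourier g)"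
    using lborel_integral_real_affine[of "-1" "\<lambda>x. (cmod (fourier g x))\<^sup>2" 0]
    by (simp add: sq_norm_def inverse_fourier_def)
  then show "sq_norm lborel (inverse_fourier g) = sq_norm lborel g" using g(5) by simp
qed

text \<open>Fubini's theorem; compactly supported square-integrable functions are integrable, so the double
  integral converges absolutely.\<close>
lemma fourier_adjoint:
  assumes f: "compactly_supported_L2 f" and g: "compactly_supported_L2 g"
  shows "inner_prod lborel (fourier f) g = inner_prod lborel f (inverse_fourier g)"
proof -
  note [measurable] = compactly_supported_L2D(2)[OF f] compactly_supported_L2D(2)[OF g]
  have int_f: "integrable lborel f" and int_g: "integrable lborel g"
    using f g by (auto dest: compactly_supported_L2D)
  let ?F = "\<lambda>(x, \<xi>). f x * cis (- 2 * pi * x * \<xi>) * cnj (g \<xi>)"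
  have meas: "?F \<in> borel_measurable (lborel \<Otimes>\<^sub>M lborel)"
    by measurable
  have "integrable (lborel \<Otimes>\<^sub>M lborel) ?F"
  proof (rule lborel_pair.Fubini_integrable[OF meas])
    show "integrable lborel (\<lambda>x. LINT \<xi>|lborel. norm (?F (x, \<xi>)))"
      using int_f by (simp add: norm_mult)
    have "integrable lborel (\<lambda>\<xi>. ?F (x, \<xi>))" for x
      unfolding prod.case
      by (rule Bochner_Integration.integrable_bound[OF integrable_mult_right[OF int_g, of "f x"]])
        (auto simp: norm_mult)
    then show "AE x in lborel. integrable lborel (\<lambda>\<xi>. ?F (x, \<xi>))" by simp
  qed
  from lborel_pair.Fubini_integral[OF this]
  have "(LINT \<xi>|lborel. LINT x|lborel. ?F (x, \<xi>)) = (LINT x|lborel. LINT \<xi>|lborel. ?F (x, \<xi>))"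
    by simp
  moreover have "(LINT x|lborel. ?F (x, \<xi>)) = fourier f \<xi> * cnj (g \<xi>)" for \<xi>
    by (simp add: fourier_def)
  moreover have "(LINT \<xi>|lborel. ?F (x, \<xi>)) = f x * cnj (inverse_fourier g x)" for x
  proof -
    have "(LINT \<xi>|lborel. ?F (x, \<xi>)) = (LINT \<xi>|lborel. f x * cnj (g \<xi> * cis (- 2 * pi * \<xi> * (- x))))"
      by (intro Bochner_Integration.integral_cong) (auto simp: cis_cnj mult_ac)
    also have "\<dots> = f x * cnj (inverse_fourier g x)"
      unfolding inverse_fourier_def fourier_def by (simp flip: Bochner_Integration.integral_cnj)
    finally show ?thesis .
  qed
  ultimately show ?thesis by (simp only: inner_prod_def)
qed

text \<open>Both sides expand to the same three terms, by Plancherel's theorem in both directions and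
  adjointness. The identity plays the role of Fourier inversion: density and convergence pass
  from one side to the other without composing the two transforms.\<close>
lemma sq_dist_fourier_eq:
  assumes f: "compactly_supported_L2 f" and g: "compactly_supported_L2 g"
  shows "sq_dist lborel (fourier f) g = sq_dist lborel f (inverse_fourier g)"
  using compactly_supported_L2D[OF f] compactly_supported_L2D[OF g] inverse_fourier_square_integrable[OF g]
  by (simp add: sq_dist_eq sq_norm_diff fourier_adjoint[OF f g])

lemma inner_prod_scale_right: "inner_prod M f (\<lambda>x. c * g x) = cnj c * inner_prod M f g"
proof -
  have "inner_prod M f (\<lambda>x. c * g x) = (LINT x|M. cnj c * (f x * cnj (g x)))"
    unfolding inner_prod_def by (intro Bochner_Integration.integral_cong) auto
  then show ?thesis by (simp add: inner_prod_def)
qed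

text \<open>Polarization: the isometry applied to \<open>g - h\<close> gives the real parts, applied to \<open>g - \<i> h\<close> the
  imaginary parts.\<close>
lemma inner_prod_inverse_fourier:
  assumes g: "compactly_supported_L2 g" and h: "compactly_supported_L2 h"
  shows "inner_prod lborel (inverse_fourier g) (inverse_fourier h) = inner_prod lborel g h"
proof -
  have Re: "Re (inner_prod lborel (inverse_fourier g) (inverse_fourier h)) = Re (inner_prod lborel g h)"
    if h: "compactly_supported_L2 h" for h
  proof -
    have h': "compactly_supported_L2 (\<lambda>x. (-1) * h x)" by (rule compactly_supported_L2_scale[OF h])
    have gh: "compactly_supported_L2 (\<lambda>x. g x - h x)"
      using compactly_supported_L2_add[OF g h'] by simp
    have "inverse_fourier (\<lambda>x. g x - h x) = (\<lambda>x. inverse_fourier g x - inverse_fourier h x)"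
      using fourier_add[OF compactly_supported_L2D(3)[OF g] compactly_supported_L2D(3)[OF h']]
        fourier_scale[of "-1" h] by (simp add: inverse_fourier_def fun_eq_iff)
    then have "sq_norm lborel (\<lambda>x. inverse_fourier g x - inverse_fourier h x) = sq_norm lborel (\<lambda>x. g x - h x)"
      using inverse_fourier_square_integrable(2)[OF gh] by simp
    then show ?thesis
      using inverse_fourier_square_integrable[OF g] inverse_fourier_square_integrable[OF h]
        compactly_supported_L2D(1)[OF g] compactly_supported_L2D(1)[OF h]
      by (simp add: sq_norm_diff)
  qed
  have "inverse_fourier (\<lambda>x. \<i> * h x) = (\<lambda>x. \<i> * inverse_fourier h x)" by (simp add: inverse_fourier_def fourier_scale fun_eq_iff)
  then have "Re (cnj \<i> * inner_prod lborel (inverse_fourier g) (inverse_fourier h)) = Re (cnj \<i> * inner_prod lborel g h)"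
    using Re[OF compactly_supported_L2_scale[OF h, of \<i>]] by (simp only: inner_prod_scale_right)
  then show ?thesis using Re[OF h] by (simp add: complex_eq_iff)
qed

lemma sq_dist_truncate_tendsto_0:
  assumes f: "square_integrable lborel (f :: real \<Rightarrow> complex)"
  shows "(\<lambda>N::nat. sq_dist lborel f (\<lambda>x. indicator {- real N..real N} x * f x)) \<longlonglongrightarrow> 0"
proof -
  note [measurable] = square_integrable_measurable[OF f]
  have "(\<lambda>N::nat. sq_dist lborel f (\<lambda>x. indicator {- real N..real N} x * f x)) \<longlonglongrightarrow> (\<integral>\<^sup>+ x. 0 \<partial>(lborel :: real measure))"
    unfolding sq_dist_def
  proof (rule nn_integral_dominated_convergence[where w = "\<lambda>x. ennreal ((cmod (f x))\<^sup>2)"])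
    show "(\<integral>\<^sup>+ x. ennreal ((cmod (f x))\<^sup>2) \<partial>lborel) < \<infinity>"
      using f by (simp add: square_integrable_iff_finite)
    show "AE x in lborel. ennreal ((cmod (f x - indicator {- real N..real N} x * f x))\<^sup>2) \<le> ennreal ((cmod (f x))\<^sup>2)" for N
      by (auto simp: indicator_def)
    show "AE x in lborel. (\<lambda>N. ennreal ((cmod (f x - indicator {- real N..real N} x * f x))\<^sup>2)) \<longlonglongrightarrow> 0"
    proof (rule AE_I2, rule tendsto_eventually)
      fix x
      obtain m where "\<bar>x\<bar> \<le> real m" using real_arch_simple by blast
      then show "\<forall>\<^sub>F N in sequentially. ennreal ((cmod (f x - indicator {- real N..real N} x * f x))\<^sup>2) = 0"
        by (intro eventually_sequentiallyI[of m]) (auto simp: indicator_def)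
    qed
  qed auto
  then show ?thesis by simp
qed

section \<open>Wavelets from simultaneous tilings\<close>
lemma AE_lborel_affine:
  assumes "c \<noteq> 0" "AE x in lborel. P (x::real)"
  shows "AE x in lborel. P (c * x)"
proof -
  obtain N where N: "N \<in> null_sets lborel" "{x. \<not> P x} \<subseteq> N"
    using assms(2) by (auto simp: eventually_ae_filter)
  have [measurable]: "N \<in> sets borel" using N by auto
  have "AE x in density (distr lborel borel (\<lambda>x. 0 + c * x)) (\<lambda>_. ennreal \<bar>c\<bar>). x \<notin> N"
    using AE_not_in[OF N(1)] by (subst (asm) lborel_real_affine[OF assms(1), of 0])
  then have "AE x in lborel. c * x \<notin> N"
    using assms(1) by (simp add: AE_density AE_distr_iff)
  then show ?thesis by eventually_elim (use N in auto)
qed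

text \<open>Lebesgue measurable functions are traded for Borel functions here once and for all, so that
  Fubini's theorem and substitution can be used for Borel measure on the line.\<close>
lemma L2_fun_imp_borel_representative:
  assumes "f \<in> L2_fun"
  obtains f' where "square_integrable lborel f'" "AE x in lborel. f x = f' x"
proof -
  have [measurable]: "f \<in> borel_measurable lebesgue" using assms by (simp add: L2_fun_def)
  have "(\<lambda>x. Re (f x)) \<in> borel_measurable lebesgue" "(\<lambda>x. Im (f x)) \<in> borel_measurable lebesgue"
    by measurable
  then obtain a b where [measurable]: "a \<in> borel_measurable lborel" "b \<in> borel_measurable lborel"
    and ab: "AE x in lborel. Re (f x) = a x" "AE x in lborel. Im (f x) = b x"
    using completion_ex_borel_measurable_real by metis
  define f' where "f' = (\<lambda>x. Complex (a x) (b x))"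
  have f'_eq: "f' = (\<lambda>x. complex_of_real (a x) + \<i> * complex_of_real (b x))"
    by (simp add: f'_def fun_eq_iff complex_eq_iff)
  have [measurable]: "f' \<in> borel_measurable lborel" unfolding f'_eq by measurable
  have AE: "AE x in lborel. f x = f' x"
    using ab by eventually_elim (simp add: f'_def complex_eq_iff)
  have "(\<integral>\<^sup>+ x. ennreal ((cmod (f' x))\<^sup>2) \<partial>lborel) = (\<integral>\<^sup>+ x. ennreal ((cmod (f x))\<^sup>2) \<partial>lebesgue)"
    unfolding nn_integral_completion using AE by (intro nn_integral_cong_AE) auto
  also have "\<dots> < \<infinity>" using assms by (auto simp: L2_fun_def integrable_iff_bounded)
  finally have "square_integrable lborel f'" by (simp add: square_integrable_iff_finite)
  then show thesis using AE by (rule that)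
qed

lemma square_integrable_imp_L2_fun:
  assumes "square_integrable lborel f"
  shows "f \<in> L2_fun"
  using assms unfolding square_integrable_def L2_fun_def
  by (auto simp: integrable_completion measurable_completion)

lemma L2_inner_eq:
  assumes [measurable]: "f \<in> borel_measurable borel" "g \<in> borel_measurable borel"
  shows "L2_inner f g = inner_prod lborel f g"
  unfolding L2_inner_def inner_prod_def by (rule integral_completion) measurable

lemma L2_dist_sq_eq: "L2_dist_sq f g = sq_dist lborel f g"
  unfolding L2_dist_sq_def sq_dist_def by (rule nn_integral_completion)

lemma fourier_integral_eq:
  assumes [measurable]: "f \<in> borel_measurable borel"
  shows "fourier_integral f = fourier f"
proof
  fix \<xi>
  have "exp (- (2 * complex_of_real pi * \<i> * of_real x * of_real \<xi>)) = cis (- 2 * pi * x * \<xi>)" for x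
    by (simp add: cis_conv_exp mult_ac)
  then have "fourier_integral f \<xi> = (LINT x|lebesgue. f x * cis (- 2 * pi * x * \<xi>))"
    unfolding fourier_integral_def by simp
  also have "\<dots> = fourier f \<xi>"
    unfolding fourier_def by (rule integral_completion) measurable
  finally show "fourier_integral f \<xi> = fourier f \<xi>" .
qed

locale wavelet_tiling =
  fixes K :: "real set"
  assumes K_borel [measurable]: "K \<in> sets borel" and bounded_K: "bounded K"
    and translates_tile: "AE x in lborel. \<exists>!m::int. x + of_int m \<in> K"
    and dilates_tile: "AE x in lborel. \<exists>!j::int. 2 powi j * x \<in> K"
begin

definition dilate :: "int \<Rightarrow> real set" where
  "dilate j = {x. x / 2 powi j \<in> K}"

text \<open>The Fourier transform of the wavelet with index \<open>(j, k)\<close>; the sign of \<open>k\<close> comes from the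
  translation in \<open>\<psi>(2\<^sup>j x - k)\<close>.\<close>
definition freq_atom :: "int \<times> int \<Rightarrow> real \<Rightarrow> complex" where
  "freq_atom = (\<lambda>(j, k) x.
     of_real (1 / sqrt (2 powi j)) * (indicator (dilate j) x * wave (- k) (x / 2 powi j)))"

definition mother_wavelet :: "real \<Rightarrow> complex" where
  "mother_wavelet = inverse_fourier (indicator K)"

lemma dilate_measurable [measurable]: "dilate j \<in> sets borel"
  unfolding dilate_def by measurable

lemma dilate_tile: "translation_tile (2 powi j) (dilate j)"
proof -
  have "AE x in lborel. \<exists>!m::int. (1 / 2 powi j) * x + of_int m \<in> K"
    using translates_tile by (intro AE_lborel_affine) auto
  moreover have "(x + of_int m * 2 powi j \<in> dilate j) = ((1 / 2 powi j) * x + of_int m \<in> K)" for x and m :: int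
    by (simp add: dilate_def add_divide_distrib)
  ultimately show ?thesis by (simp add: translation_tile_def)
qed

lemma dilate_bounded: obtains R where "dilate j \<subseteq> {-R..R}"
proof -
  obtain R where R: "\<And>x. x \<in> K \<Longrightarrow> \<bar>x\<bar> \<le> R" using bounded_K by (auto simp: bounded_iff)
  have "x \<in> {- (R * 2 powi j)..R * 2 powi j}" if "x \<in> dilate j" for x
  proof -
    have "\<bar>x / 2 powi j\<bar> \<le> R" using R[of "x / 2 powi j"] that unfolding dilate_def by blast
    then have "\<bar>x\<bar> \<le> R * 2 powi j" by (simp add: pos_divide_le_eq)
    then show ?thesis by auto
  qed
  then show thesis by (intro that[of "R * 2 powi j"] subsetI)
qed

lemma freq_atom_compact: "compactly_supported_L2 (freq_atom i)"
proof -
  obtain j k where i: "i = (j, k)" by (cases i)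
  obtain R where R: "dilate j \<subseteq> {-R..R}" by (rule dilate_bounded)
  have "emeasure lborel (dilate j) = ennreal (2 powi j)"
    by (rule emeasure_tile[OF _ _ dilate_tile]) auto
  then have "square_integrable lborel (freq_atom i)"
    unfolding freq_atom_def i prod.case by (intro square_integrable_wave) auto
  moreover have "freq_atom i x = 0" if "x \<notin> {-R..R}" for x
    using R that by (auto simp: freq_atom_def i indicator_def)
  ultimately show ?thesis unfolding compactly_supported_L2_def by blast
qed

lemma indicator_compact: "compactly_supported_L2 (\<lambda>x. indicator K x)"
  using freq_atom_compact[of "(0, 0)"] by (simp add: freq_atom_def dilate_def)

text \<open>Substitution \<open>\<xi> = 2\<^sup>j \<eta>\<close> in the inverse Fourier integral.\<close>
lemma wavelet_system_eq: "wavelet_system mother_wavelet i = inverse_fourier (freq_atom i)"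
proof
  fix x
  obtain j k where i: "i = (j, k)" by (cases i)
  define T :: real where "T = 2 powi j"
  have T: "T > 0" by (simp add: T_def)
  have sqrt_T: "2 powr (of_int j / 2) = sqrt T"
  proof -
    have "T = 2 powr of_int j" by (simp add: T_def powr_real_of_int')
    then show ?thesis by (simp add: powr_powr flip: powr_half_sqrt)
  qed
  have "inverse_fourier (freq_atom i) x
      = (LINT \<xi>|lborel. freq_atom i \<xi> * cis (2 * pi * \<xi> * x))"
    by (simp add: inverse_fourier_def fourier_def)
  also have "\<dots> = T *\<^sub>R (LINT \<xi>|lborel. freq_atom i (0 + T * \<xi>) * cis (2 * pi * (0 + T * \<xi>) * x))"
    using lborel_integral_real_affine[of T "\<lambda>\<xi>. freq_atom i \<xi> * cis (2 * pi * \<xi> * x)" 0] T by simp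
  also have "(LINT \<xi>|lborel. freq_atom i (0 + T * \<xi>) * cis (2 * pi * (0 + T * \<xi>) * x))
      = (LINT \<xi>|lborel. of_real (1 / sqrt T) * (indicator K \<xi> * cis (- 2 * pi * \<xi> * (- (T * x - of_int k)))))"
  proof (intro Bochner_Integration.integral_cong refl)
    fix \<xi>
    have "wave (- k) \<xi> * cis (2 * pi * (T * \<xi>) * x) = cis (- 2 * pi * \<xi> * (- (T * x - of_int k)))"
      by (simp add: cis_mult algebra_simps)
    then show "freq_atom i (0 + T * \<xi>) * cis (2 * pi * (0 + T * \<xi>) * x)
      = of_real (1 / sqrt T) * (indicator K \<xi> * cis (- 2 * pi * \<xi> * (- (T * x - of_int k))))"
      using T by (simp add: freq_atom_def i dilate_def indicator_def mult.assoc flip: T_def)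
  qed
  also have "\<dots> = of_real (1 / sqrt T) * mother_wavelet (T * x - of_int k)"
    by (simp add: mother_wavelet_def inverse_fourier_def fourier_def)
  also have "T *\<^sub>R \<dots> = of_real (T / sqrt T) * mother_wavelet (T * x - of_int k)"
    by (simp add: scaleR_conv_of_real)
  also have "T / sqrt T = sqrt T" using T by (simp add: real_div_sqrt)
  finally show "wavelet_system mother_wavelet i x = inverse_fourier (freq_atom i) x"
    by (simp add: wavelet_system_def i sqrt_T T_def)
qed

text \<open>Within one scale this is orthogonality of exponentials on a tile; across scales the supports
  are disjoint by the dilation tiling.\<close>
lemma freq_atom_orthonormal:
  "inner_prod lborel (freq_atom i) (freq_atom i') = (if i = i' then 1 else 0)"
proof -
  obtain j k j' k' where i: "i = (j, k)" "i' = (j', k')" by (cases i, cases i')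
  show ?thesis
  proof (cases "j = j'")
    case True
    have "inner_prod lborel (freq_atom i) (freq_atom i') = (if - k = - k' then 1 else 0)"
      unfolding freq_atom_def i prod.case True[symmetric]
      by (rule inner_prod_waves_tile[OF _ _ dilate_tile]) auto
    then show ?thesis using i True by simp
  next
    case False
    have "AE x in lborel. freq_atom i x * cnj (freq_atom i' x) = 0"
      using dilates_tile
    proof eventually_elim
      case (elim x)
      have "\<not> (x \<in> dilate j \<and> x \<in> dilate j')"
      proof
        assume "x \<in> dilate j \<and> x \<in> dilate j'"
        then have "2 powi (- j) * x \<in> K" "2 powi (- j') * x \<in> K"
          by (simp_all add: dilate_def power_int_minus field_simps)
        then have "- j = - j'" using elim by blast
        with False show False by simp
      qed
      then show ?case by (auto simp: freq_atom_def i indicator_def)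
    qed
    then show ?thesis
      using i False unfolding inner_prod_def by (simp add: integral_eq_zero_AE)
  qed
qed

text \<open>The restriction of \<open>f\<close> to each band \<open>dilate j\<close> is approximated by exponentials of that band. By
  the dilation tiling the sum of the bands with \<open>|j| \<le> N\<close> converges to \<open>f\<close> and is dominated by
  \<open>|f|\<close>.\<close>
lemma freq_atom_dense:
  assumes f: "square_integrable lborel f"
  shows "f \<in> L2_closure lborel (finite_span freq_atom)"
proof -
  interpret measurable_function_space lborel "finite_span freq_atom"
    using compactly_supported_L2D(2)[OF freq_atom_compact] by (intro finite_span_space) simp
  note [measurable] = square_integrable_measurable[OF f]
  have atom: "freq_atom i \<in> L2_closure lborel (finite_span freq_atom)" for i
    by (rule subset_closure[OF member_finite_span])
  have band: "(\<lambda>x. indicator (dilate j) x * f x) \<in> L2_closure lborel (finite_span freq_atom)" for j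
  proof (rule closure_closed)
    show "(\<lambda>x. indicator (dilate j) x * f x) \<in> borel_measurable lborel" by measurable
    fix \<delta> :: real assume \<delta>: "\<delta> > 0"
    obtain R where R: "dilate j \<subseteq> {-R..R}" by (rule dilate_bounded)
    have "square_integrable lborel (\<lambda>x. indicator (dilate j) x * f x)"
      unfolding square_integrable_def
    proof
      show "integrable lborel (\<lambda>x. (cmod (indicator (dilate j) x * f x))\<^sup>2)"
      proof (rule Bochner_Integration.integrable_bound)
        show "integrable lborel (\<lambda>x. (cmod (f x))\<^sup>2)" using f by (simp add: square_integrable_def)
      qed (auto simp: indicator_def)
    qed measurable
    then have "\<exists>J c. finite J \<and> sq_dist lborel (\<lambda>x. indicator (dilate j) x * f x)
        (\<lambda>x. \<Sum>k\<in>J. c k * (indicator (dilate j) x * wave k (x / 2 powi j))) \<le> ennreal \<delta>"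
      using R by (intro exponentials_dense_on_packing_set tile_imp_packing dilate_tile \<delta>)
        (auto intro: bounded_subset[OF bounded_closed_interval])
    then obtain J c where J: "finite J" "sq_dist lborel (\<lambda>x. indicator (dilate j) x * f x)
        (\<lambda>x. \<Sum>k\<in>J. c k * (indicator (dilate j) x * wave k (x / 2 powi j))) \<le> ennreal \<delta>"
      by blast
    have "c k * (indicator (dilate j) x * wave k (x / 2 powi j))
        = (c k * of_real (sqrt (2 powi j))) * freq_atom (j, - k) x" for k x
      by (simp add: freq_atom_def)
    then have eq: "(\<lambda>x. \<Sum>k\<in>J. c k * (indicator (dilate j) x * wave k (x / 2 powi j)))
        = (\<lambda>x. \<Sum>k\<in>J. (c k * of_real (sqrt (2 powi j))) * freq_atom (j, - k) x)"
      by (simp only:)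
    have "(\<lambda>x. \<Sum>k\<in>J. (c k * of_real (sqrt (2 powi j))) * freq_atom (j, - k) x)
        \<in> L2_closure lborel (finite_span freq_atom)"
      by (intro closure_sum closure_scale atom J)
    then show "\<exists>g\<in>L2_closure lborel (finite_span freq_atom).
        sq_dist lborel (\<lambda>x. indicator (dilate j) x * f x) g \<le> ennreal \<delta>"
      using J(2) unfolding eq by blast
  qed
  have once: "AE x in lborel. \<exists>j. \<forall>l. x \<in> dilate l \<longleftrightarrow> l = j"
    using dilates_tile
  proof eventually_elim
    case (elim x)
    then obtain j where j: "2 powi j * x \<in> K" "\<And>l. 2 powi l * x \<in> K \<Longrightarrow> l = j" by blast
    have "x \<in> dilate l \<longleftrightarrow> 2 powi (- l) * x \<in> K" for l
      by (simp add: dilate_def power_int_minus field_simps)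
    then have "\<forall>l. x \<in> dilate l \<longleftrightarrow> l = - j" using j by (metis minus_equation_iff)
    then show ?case by blast
  qed
  let ?F = "\<lambda>N::nat. \<lambda>x. \<Sum>j\<in>{- int N..int N}. indicator (dilate j) x * f x"
  have F: "AE x in lborel. \<exists>j. \<forall>N. ?F N x = (if j \<in> {- int N..int N} then f x else 0)"
    using once
  proof eventually_elim
    case (elim x)
    then obtain j where j: "\<And>l. x \<in> dilate l \<longleftrightarrow> l = j" by blast
    have "?F N x = (\<Sum>l\<in>{- int N..int N}. if l = j then f x else 0)" for N
      by (intro sum.cong) (auto simp: j)
    then show ?case by auto
  qed
  show ?thesis
  proof (rule closure_limit[where F = ?F and w = "\<lambda>x. cmod (f x)"])
    show "?F N \<in> L2_closure lborel (finite_span freq_atom)" for N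
      by (intro closure_sum band) auto
    show "AE x in lborel. (\<lambda>N. ?F N x) \<longlonglongrightarrow> f x"
      using F
    proof eventually_elim
      case (elim x)
      then obtain j where j: "\<And>N. ?F N x = (if j \<in> {- int N..int N} then f x else 0)" by blast
      show ?case
        unfolding j by (intro tendsto_eventually eventually_sequentiallyI[of "nat \<bar>j\<bar>"]) auto
    qed
    show "AE x in lborel. cmod (?F N x) \<le> cmod (f x)" for N
      using F by eventually_elim auto
  qed (use f in \<open>auto simp: square_integrable_iff_finite\<close>)
qed

lemma mother_wavelet_square_integrable: "square_integrable lborel mother_wavelet"
  unfolding mother_wavelet_def by (rule inverse_fourier_square_integrable[OF indicator_compact])

lemma truncation_compact:
  assumes f: "square_integrable lborel f"
  shows "compactly_supported_L2 (\<lambda>x. indicator {- real N..real N} x * f x)"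
proof -
  note [measurable] = square_integrable_measurable[OF f]
  have "integrable lborel (\<lambda>x. (cmod (indicator {- real N..real N} x * f x))\<^sup>2)"
  proof (rule Bochner_Integration.integrable_bound)
    show "integrable lborel (\<lambda>x. (cmod (f x))\<^sup>2)" using f by (simp add: square_integrable_def)
  qed (auto simp: indicator_def)
  then show ?thesis
    unfolding compactly_supported_L2_def square_integrable_def
    by (auto intro!: exI[of _ "real N"] simp: indicator_def)
qed

text \<open>By \<open>sq_dist_fourier_eq\<close> the transforms of the truncations are as far from the indicator of \<open>K\<close> as
  the truncations are from the wavelet itself, which is square-integrable.\<close>
lemma mother_wavelet_fourier_transform: "mother_wavelet has_L2_fourier_transform (indicator K)"
  unfolding has_L2_fourier_transform_def
proof (intro conjI)
  show "mother_wavelet \<in> L2_fun" by (rule square_integrable_imp_L2_fun[OF mother_wavelet_square_integrable])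
  show "indicator K \<in> L2_fun"
    using compactly_supported_L2D(1)[OF indicator_compact] by (rule square_integrable_imp_L2_fun)
  note [measurable] = square_integrable_measurable[OF mother_wavelet_square_integrable]
  have "L2_dist_sq (fourier_integral (\<lambda>x. indicator {- real N..real N} x * mother_wavelet x)) (indicator K)
      = sq_dist lborel mother_wavelet (\<lambda>x. indicator {- real N..real N} x * mother_wavelet x)" for N
  proof -
    have "L2_dist_sq (fourier_integral (\<lambda>x. indicator {- real N..real N} x * mother_wavelet x)) (indicator K)
      = sq_dist lborel (fourier (\<lambda>x. indicator {- real N..real N} x * mother_wavelet x)) (indicator K)"
      by (subst fourier_integral_eq) (auto simp: L2_dist_sq_eq)
    also have "\<dots> = sq_dist lborel (\<lambda>x. indicator {- real N..real N} x * mother_wavelet x) mother_wavelet"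
      unfolding mother_wavelet_def
      by (intro sq_dist_fourier_eq truncation_compact indicator_compact
          mother_wavelet_square_integrable[unfolded mother_wavelet_def])
    also have "\<dots> = sq_dist lborel mother_wavelet (\<lambda>x. indicator {- real N..real N} x * mother_wavelet x)"
      unfolding sq_dist_def by (simp add: norm_minus_commute)
    finally show ?thesis .
  qed
  then show "(\<lambda>N::nat. L2_dist_sq (fourier_integral (\<lambda>x. indicator {- real N..real N} x * mother_wavelet x)) (indicator K))
      \<longlonglongrightarrow> 0"
    using sq_dist_truncate_tendsto_0[OF mother_wavelet_square_integrable] by simp
qed

text \<open>A compactly supported \<open>g\<close> has its transform within a given distance of a combination of frequency
  atoms; by \<open>sq_dist_fourier_eq\<close> the corresponding combination of wavelets is within the same
  distance of \<open>g\<close>. Truncations reduce the general case to this one.\<close>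
lemma wavelet_system_dense:
  assumes f: "square_integrable lborel f"
  shows "f \<in> L2_closure lborel (finite_span (wavelet_system mother_wavelet))"
proof -
  have ws: "wavelet_system mother_wavelet i \<in> borel_measurable borel" for i
    unfolding wavelet_system_eq using compactly_supported_L2D(2)[OF freq_atom_compact[of i]] by measurable
  interpret measurable_function_space lborel "finite_span (wavelet_system mother_wavelet)"
    by (rule finite_span_space) (simp add: ws)
  note [measurable] = square_integrable_measurable[OF f]
  show ?thesis
  proof (rule closure_closed)
    show "f \<in> borel_measurable lborel" by measurable
    fix \<delta> :: real assume \<delta>: "\<delta> > 0"
    have "\<forall>\<^sub>F N in sequentially. sq_dist lborel f (\<lambda>x. indicator {- real N..real N} x * f x) < ennreal \<delta>"
      using order_tendstoD(2)[OF sq_dist_truncate_tendsto_0[OF f], of "ennreal \<delta>"] \<delta> by simp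
    then obtain N where N: "sq_dist lborel f (\<lambda>x. indicator {- real N..real N} x * f x) < ennreal \<delta>"
      by (auto simp: eventually_sequentially)
    let ?g = "\<lambda>x. indicator {- real N..real N} x * f x"
    have g: "compactly_supported_L2 ?g" by (rule truncation_compact[OF f])
    have "?g \<in> L2_closure lborel (finite_span (wavelet_system mother_wavelet))"
      unfolding L2_closure_def
    proof (intro CollectI conjI allI impI)
      show "?g \<in> borel_measurable lborel" by measurable
      fix \<eta> :: real assume "\<eta> > 0"
      then obtain h where h: "h \<in> finite_span freq_atom" "sq_dist lborel (fourier ?g) h \<le> ennreal \<eta>"
        using freq_atom_dense[OF compactly_supported_L2D(4)[OF g]] unfolding L2_closure_def by blast
      obtain J c where J: "finite J" "h = (\<lambda>x. \<Sum>i\<in>J. c i * freq_atom i x)"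
        using h(1) unfolding finite_span_def by blast
      have "compactly_supported_L2 h"
        unfolding J(2) using J(1)
        by (intro compactly_supported_L2_sum compactly_supported_L2_scale freq_atom_compact)
      then have "sq_dist lborel ?g (inverse_fourier h) \<le> ennreal \<eta>"
        using h(2) by (simp add: sq_dist_fourier_eq[OF g])
      moreover have "inverse_fourier h = (\<lambda>x. \<Sum>i\<in>J. c i * wavelet_system mother_wavelet i x)"
        unfolding J(2) by (rule ext) (simp add: inverse_fourier_sum[OF J(1) freq_atom_compact] wavelet_system_eq)
      then have "inverse_fourier h \<in> finite_span (wavelet_system mother_wavelet)"
        unfolding finite_span_def using J(1) by auto
      ultimately show "\<exists>g\<in>finite_span (wavelet_system mother_wavelet). sq_dist lborel ?g g \<le> ennreal \<eta>" by blast
    qed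
    then show "\<exists>g\<in>L2_closure lborel (finite_span (wavelet_system mother_wavelet)). sq_dist lborel f g \<le> ennreal \<delta>"
      using N by (auto intro: less_imp_le)
  qed
qed

lemma wavelet_system_orthonormal_basis: "L2_orthonormal_basis UNIV (wavelet_system mother_wavelet)"
  unfolding L2_orthonormal_basis_def
proof (intro conjI ballI allI impI)
  have si: "square_integrable lborel (wavelet_system mother_wavelet i)" for i
    unfolding wavelet_system_eq by (rule inverse_fourier_square_integrable[OF freq_atom_compact])
  show "wavelet_system mother_wavelet i \<in> L2_fun" for i
    by (rule square_integrable_imp_L2_fun[OF si])
  show "L2_inner (wavelet_system mother_wavelet i) (wavelet_system mother_wavelet i') = (if i = i' then 1 else 0)" for i i'
    using square_integrable_measurable[OF si] freq_atom_orthonormal[of i i']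
    by (subst L2_inner_eq) (simp_all add: wavelet_system_eq inner_prod_inverse_fourier freq_atom_compact)
  fix f :: "real \<Rightarrow> complex" and \<delta> :: ennreal assume f: "f \<in> L2_fun" and \<delta>: "\<delta> > 0"
  obtain f' where f': "square_integrable lborel f'" "AE x in lborel. f x = f' x"
    using f by (rule L2_fun_imp_borel_representative)
  obtain \<delta>' where \<delta>': "\<delta>' > 0" "ennreal \<delta>' < \<delta>"
  proof -
    obtain d where d: "0 < d" "d < \<delta>" using dense[OF \<delta>] by blast
    then have "d < top" by (auto intro: less_le_trans)
    then show thesis using d that[of "enn2real d"] by (simp add: enn2real_positive_iff)
  qed
  from this(1) obtain g where g: "g \<in> finite_span (wavelet_system mother_wavelet)" "sq_dist lborel f' g \<le> ennreal \<delta>'"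
    using wavelet_system_dense[OF f'(1)] unfolding L2_closure_def by blast
  obtain J c where J: "finite J" "g = (\<lambda>x. \<Sum>i\<in>J. c i * wavelet_system mother_wavelet i x)"
    using g(1) unfolding finite_span_def by blast
  have "L2_dist_sq f g = sq_dist lborel f' g"
    unfolding L2_dist_sq_eq using f'(2) by (intro sq_dist_cong_AE) auto
  then have "L2_dist_sq f g < \<delta>" using g(2) \<delta>'(2) by simp
  then show "\<exists>J c. finite J \<and> J \<subseteq> UNIV \<and>
      L2_dist_sq f (\<lambda>x. \<Sum>i\<in>J. c i * wavelet_system mother_wavelet i x) < \<delta>"
    using J by blast
qed

text \<open>The wavelet is the inverse Fourier transform of the indicator of \<open>K\<close>, so its Fourier transform has
  modulus one on \<open>K\<close> and vanishes elsewhere.\<close>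
theorem wavelet_set: "wavelet_set K"
  unfolding wavelet_set_def orthonormal_wavelet_def
proof (intro conjI exI)
  show "K \<in> sets lebesgue" by simp
  show "mother_wavelet \<in> L2_fun" by (rule square_integrable_imp_L2_fun[OF mother_wavelet_square_integrable])
  show "L2_orthonormal_basis UNIV (wavelet_system mother_wavelet)" by (rule wavelet_system_orthonormal_basis)
  show "mother_wavelet has_L2_fourier_transform (indicator K)" by (rule mother_wavelet_fourier_transform)
  show "AE \<xi> in lebesgue. cmod (indicator K \<xi>) = indicator K \<xi>" by (auto simp: indicator_def)
qed

end

section \<open>The geometry of the set\<close>
lemma same_octave:
  assumes "c < 2 powi i * z" "2 powi i * z < 2 * c" "c < 2 powi j * z" "2 powi j * z < 2 * c"
    and c: "(c::real) > 0"
  shows "i = j"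
proof -
  have *: False if "i < j" "c < 2 powi i * z" "2 powi j * z < 2 * c" for i j :: int
  proof -
    have z: "z > 0" using that c by (smt (verit) mult_nonneg_nonpos zero_le_power_int)
    have "2 * 2 powi i = (2 powi (i + 1) :: real)" by (simp add: power_int_add)
    also have "\<dots> \<le> 2 powi j" using that by (intro power_int_increasing) auto
    finally have "2 * 2 powi i * z \<le> 2 powi j * z" using z by (intro mult_right_mono) auto
    then show False using that by simp
  qed
  show ?thesis using *[of i j] *[of j i] assms by (cases i j rule: linorder_cases) auto
qed

lemma octave_exists:
  assumes "(c::real) > 0" "z > 0"
  obtains i :: int where "c < 2 powi i * z" "2 powi i * z \<le> 2 * c"
proof -
  define i where "i = \<lfloor>log 2 (2 * c / z)\<rfloor>"
  have pos: "2 * c / z > 0" using assms by simp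
  have "real_of_int i \<le> log 2 (2 * c / z)" "log 2 (2 * c / z) < real_of_int (i + 1)"
    unfolding i_def by linarith+
  then have "2 powr i \<le> 2 * c / z" "2 * c / z < 2 powr (i + 1)"
    using pos by (simp_all add: le_log_iff log_less_iff)
  then have "2 powi i \<le> 2 * c / z" "2 * c / z < 2 * 2 powi i"
    by (simp_all add: powr_add powr_real_of_int')
  then have "2 powi i * z \<le> 2 * c" "c < 2 powi i * z"
    using assms by (simp_all add: field_simps)
  then show thesis by (rule that[rotated])
qed

text \<open>The bound on \<open>\<epsilon>\<close> enters through two consequences only: \<open>a + 2 \<epsilon> < 1/2\<close>, so that \<open>S_2\<close> is
  nondegenerate, and \<open>\<epsilon> < a/2\<close>, so that \<open>S_1\<close> stays inside \<open>(a/2, a]\<close>.\<close>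
locale parameters =
  fixes n :: nat and \<epsilon> :: real
  assumes n: "n \<ge> 2" and \<epsilon>_pos: "0 < \<epsilon>" and \<epsilon>_less: "\<epsilon> < e_par n / 4"
begin

text \<open>A constant rather than an abbreviation: simplification would otherwise discharge \<open>1 \<le> N\<close> as a
  trivial fact about powers before linear arithmetic can use it.\<close>
definition N :: real where
  "N = 2 ^ (n - 2)"

abbreviation "a \<equiv> a_par n"
abbreviation "d \<equiv> d_par n"
abbreviation "E \<equiv> E_set n \<epsilon>"
abbreviation "F \<equiv> F_set n \<epsilon>"
abbreviation "S1 \<equiv> S1_set n \<epsilon>"

lemma N_ge_1: "N \<ge> 1" by (simp add: N_def)

lemma two_power_n: "2 ^ n = 4 * N"
  using power_add[of "2::real" 2 "n - 2"] unfolding le_add_diff_inverse[OF n] N_def by simp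

lemma two_power_n_minus_1: "2 ^ (n - 1) = 2 * N"
proof -
  have "n - 1 = Suc (n - 2)" using n by simp
  then show ?thesis by (simp only: power_Suc N_def)
qed

lemma a_eq: "a = N / (4 * N - 1)"
  by (simp add: a_par_def two_power_n N_def[symmetric])

lemma d_eq: "d = N + a" "d = 4 * N * a"
proof -
  have "(2::real) ^ (2 * n - 2) = 2 ^ (n + (n - 2))" using n by (intro arg_cong[of _ _ "power 2"]) simp
  also have "\<dots> = 4 * N * N" by (simp only: power_add two_power_n N_def[symmetric])
  finally have d: "d = 4 * N * N / (4 * N - 1)" by (simp add: d_par_def two_power_n)
  show "d = 4 * N * a" unfolding d a_eq by simp
  show "d = N + a" unfolding d a_eq using N_ge_1 by (simp add: field_simps)
qed

lemma a_bounds: "1 / 4 < a" "a < 1 / 2"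
  unfolding a_eq using N_ge_1 by (simp_all add: field_simps)

lemma \<epsilon>_bounds: "a + 2 * \<epsilon> < 1 / 2" "\<epsilon> < a / 2"
proof -
  have "e_par n = 1 - 2 * a"
    unfolding e_par_def two_power_n two_power_n_minus_1 a_eq using N_ge_1 by (simp add: field_simps)
  then show "a + 2 * \<epsilon> < 1 / 2" using \<epsilon>_less by simp
  then show "\<epsilon> < a / 2" using a_bounds by simp
qed

lemma S1_eq: "S1 = {a / 2 + \<epsilon> / (4 * N)..a / 2 + \<epsilon>}"
  by (simp add: S1_set_def two_power_n)

lemma S1_bounds: "x \<in> S1 \<Longrightarrow> a / 2 < x \<and> x \<le> a"
proof -
  have "\<epsilon> / (4 * N) > 0" using \<epsilon>_pos N_ge_1 by simp
  then show "x \<in> S1 \<Longrightarrow> a / 2 < x \<and> x \<le> a"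
    unfolding S1_eq using \<epsilon>_bounds(2) by auto
qed

lemma E_0_iff: "x \<in> E 0 \<longleftrightarrow> x - N \<in> S1"
  unfolding N_def by (auto simp: image_iff intro!: bexI[of _ "x - 2 ^ (n - 2)"])

lemma E_Suc_iff: "x \<in> E (Suc l) \<longleftrightarrow> x - N \<in> F l"
  unfolding N_def by (auto simp: image_iff simp del: F_set.simps intro!: bexI[of _ "x - 2 ^ (n - 2)"])

lemma F_iff: "x \<in> F l \<longleftrightarrow> 2 ^ (n + l + 1) * x \<in> E l"
  by (auto simp: image_iff intro!: bexI[of _ "2 ^ (n + l + 1) * x"])

declare E_set.simps [simp del] F_set.simps [simp del]

lemma E_bounds: "x \<in> E l \<Longrightarrow> N \<le> x \<and> x \<le> d"
  and F_bounds: "y \<in> F l \<Longrightarrow> 1 / 8 / 2 ^ l \<le> y \<and> y \<le> a / 2 / 2 ^ l"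
proof -
  have F: "1 / 8 / 2 ^ l \<le> y \<and> y \<le> a / 2 / 2 ^ l"
    if E: "\<And>x. x \<in> E l \<Longrightarrow> N \<le> x \<and> x \<le> d" and y: "y \<in> F l" for l y
  proof -
    have "N \<le> 2 ^ (n + l + 1) * y \<and> 2 ^ (n + l + 1) * y \<le> 4 * N * a"
      using E y unfolding F_iff d_eq(2)[symmetric] by blast
    moreover have "(2::real) ^ (n + l + 1) = N * (8 * 2 ^ l)"
      by (simp add: power_add two_power_n)
    ultimately have "N * 1 \<le> N * (8 * 2 ^ l * y) \<and> N * (8 * 2 ^ l * y) \<le> N * (4 * a)"
      by (simp add: mult_ac)
    then have "1 \<le> 8 * 2 ^ l * y \<and> 8 * 2 ^ l * y \<le> 4 * a"
      using N_ge_1 by (simp only: mult_le_cancel_left_pos)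
    then show ?thesis by (simp add: field_simps)
  qed
  have E: "N \<le> x \<and> x \<le> d" if "x \<in> E l" for x l
    using that
  proof (induction l arbitrary: x)
    case 0
    then have "a / 2 < x - N \<and> x - N \<le> a" unfolding E_0_iff by (rule S1_bounds)
    then show ?case using a_bounds d_eq(1) by simp
  next
    case (Suc l)
    then have y: "x - N \<in> F l" by (simp add: E_Suc_iff)
    have "1 / 8 / 2 ^ l \<le> x - N \<and> x - N \<le> a / 2 / 2 ^ l" by (rule F[OF Suc.IH y])
    moreover have "a / 2 / 2 ^ l \<le> a / 2 / 1" using a_bounds by (intro divide_left_mono) auto
    moreover have "0 \<le> 1 / 8 / (2::real) ^ l" by simp
    ultimately show ?case using a_bounds d_eq(1) by linarith
  qed
  show "x \<in> E l \<Longrightarrow> N \<le> x \<and> x \<le> d" by (rule E)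
  show "y \<in> F l \<Longrightarrow> 1 / 8 / 2 ^ l \<le> y \<and> y \<le> a / 2 / 2 ^ l" by (rule F[OF E])
qed

lemma F_pos: "y \<in> F l \<Longrightarrow> 0 < y \<and> y \<le> a / 2"
proof -
  assume y: "y \<in> F l"
  have "a / 2 / 2 ^ l \<le> a / 2 / 1" using a_bounds by (intro divide_left_mono) auto
  moreover have "0 < 1 / 8 / (2::real) ^ l" by simp
  ultimately show ?thesis using F_bounds[OF y] by linarith
qed

text \<open>Since \<open>a < 1/2\<close>, the intervals from \<open>1/(8 \<cdot> 2\<^sup>l)\<close> to \<open>a/(2 \<cdot> 2\<^sup>l)\<close> that contain the sets \<open>F_l\<close> are
  pairwise disjoint.\<close>
lemma F_inj:
  assumes "x \<in> F l" "x \<in> F m" shows "l = m"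
proof -
  have *: False if "l < m" "x \<in> F l" "x \<in> F m" for l m
  proof -
    have "(2::real) ^ Suc l \<le> 2 ^ m" using that by (intro power_increasing) auto
    then have "a / 2 / 2 ^ m \<le> a / 2 / 2 ^ Suc l" using a_bounds by (intro divide_left_mono) auto
    also have "\<dots> < 1 / 8 / 2 ^ l" using a_bounds by (simp add: field_simps)
    finally show False using F_bounds[OF that(2)] F_bounds[OF that(3)] by linarith
  qed
  show ?thesis using *[of l m] *[of m l] assms by (cases l m rule: linorder_cases) auto
qed

text \<open>Subtracting \<open>N\<close> turns the \<open>E_l\<close> into \<open>S_1, F_0, F_1, \<dots>\<close>, and \<open>S_1\<close> lies to the right of
  \<open>a/2\<close>, beyond all the \<open>F_l\<close>.\<close>
lemma E_inj:
  assumes "x \<in> E l" "x \<in> E m" shows "l = m"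
proof -
  have "x - N \<notin> F k" if "x - N \<in> S1" for k
    using S1_bounds[OF that] F_pos[of "x - N" k] by fastforce
  then show ?thesis using assms F_inj[of "x - N"]
    by (cases l; cases m) (auto simp: E_0_iff E_Suc_iff)
qed

text \<open>The part of \<open>[0, a]\<close> that belongs to the set itself, so that its translate by \<open>N\<close>, the union of
  the \<open>E_l\<close>, has to be left out.\<close>
definition moved :: "real set" where
  "moved = S1 \<union> (\<Union>l. F l)"

lemma E_iff_moved: "(\<exists>l. x \<in> E l) \<longleftrightarrow> x - N \<in> moved"
proof
  assume "\<exists>l. x \<in> E l"
  then obtain l where "x \<in> E l" by blast
  then show "x - N \<in> moved" by (cases l) (auto simp: moved_def E_0_iff E_Suc_iff)
next
  assume "x - N \<in> moved"
  then show "\<exists>l. x \<in> E l" unfolding moved_def using E_0_iff E_Suc_iff by blast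
qed

lemma moved_bounds: "x \<in> moved \<Longrightarrow> 0 < x \<and> x \<le> a"
  unfolding moved_def using S1_bounds F_pos a_bounds by fastforce

definition pos_part :: "real set" where
  "pos_part = (R2_ivl n - (\<Union>l. E l)) \<union> (\<Union>l. F l) \<union> (S1 \<union> S2_set n \<epsilon> \<union> S3_set n \<epsilon>)"

lemma pos_part_iff:
  "x \<in> pos_part \<longleftrightarrow> (N \<le> x \<and> x \<le> d \<and> (\<forall>l. x \<notin> E l)) \<or> (\<exists>l. x \<in> F l) \<or> x \<in> S1
     \<or> (a + 2 * \<epsilon> \<le> x \<and> x \<le> 1 / 2) \<or> (d \<le> x \<and> x \<le> d + 2 * \<epsilon>)"
  by (auto simp: pos_part_def R2_ivl_def S2_set_def S3_set_def N_def)

lemma pos_part_bounds: "x \<in> pos_part \<Longrightarrow> 0 < x \<and> x \<le> N + 1 / 2"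
proof -
  assume "x \<in> pos_part"
  then consider "N \<le> x" "x \<le> d" | "x \<in> moved" | "a + 2 * \<epsilon> \<le> x" "x \<le> 1 / 2" | "d \<le> x" "x \<le> d + 2 * \<epsilon>"
    unfolding pos_part_iff moved_def by blast
  then show ?thesis
    using moved_bounds[of x] a_bounds \<epsilon>_bounds \<epsilon>_pos N_ge_1 d_eq(1) by cases linarith+
qed

lemma K_iff: "x \<in> K_set n \<epsilon> \<longleftrightarrow> x \<in> pos_part \<or> - x \<in> pos_part"
proof -
  have neg: "x \<in> uminus ` A \<longleftrightarrow> - x \<in> A" for A :: "real set"
    by (auto simp: image_iff intro!: bexI[of _ "- x"])
  have "x \<in> L2_ivl n \<longleftrightarrow> - x \<in> R2_ivl n" by (auto simp: L2_ivl_def R2_ivl_def)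
  moreover have "x \<in> (\<Union>l. G_set n \<epsilon> l) \<longleftrightarrow> - x \<in> (\<Union>l. E l)"
    "x \<in> (\<Union>l. H_set n \<epsilon> l) \<longleftrightarrow> - x \<in> (\<Union>l. F l)"
    by (simp_all add: G_set_def H_set_def neg)
  moreover have "x \<in> T1_set n \<epsilon> \<longleftrightarrow> - x \<in> S1_set n \<epsilon>" "x \<in> T2_set n \<epsilon> \<longleftrightarrow> - x \<in> S2_set n \<epsilon>"
    "x \<in> T3_set n \<epsilon> \<longleftrightarrow> - x \<in> S3_set n \<epsilon>"
    by (simp_all add: T1_set_def T2_set_def T3_set_def neg)
  ultimately show ?thesis unfolding K_set_def pos_part_def by blast
qed

lemma K_uminus: "- x \<in> K_set n \<epsilon> \<longleftrightarrow> x \<in> K_set n \<epsilon>"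
  unfolding K_iff minus_minus by blast

lemma bounded_K: "bounded (K_set n \<epsilon>)"
proof (rule bounded_subset[OF bounded_closed_interval])
  show "K_set n \<epsilon> \<subseteq> {- (N + 1 / 2)..N + 1 / 2}"
  proof
    fix x assume "x \<in> K_set n \<epsilon>"
    then have "0 < x \<and> x \<le> N + 1 / 2 \<or> 0 < - x \<and> - x \<le> N + 1 / 2"
      unfolding K_iff using pos_part_bounds by blast
    then show "x \<in> {- (N + 1 / 2)..N + 1 / 2}"
      unfolding atLeastAtMost_iff using N_ge_1 by linarith
  qed
qed

lemma symmetric_K: "symmetric_set (K_set n \<epsilon>)"
  unfolding symmetric_set_def
proof (rule set_eqI)
  fix x
  have "x \<in> uminus ` (K_set n \<epsilon> \<inter> {0..}) \<longleftrightarrow> - x \<in> K_set n \<epsilon> \<inter> {0..}"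
    by (metis (no_types) imageE image_eqI minus_minus)
  then show "x \<in> K_set n \<epsilon> \<inter> {..0} \<longleftrightarrow> x \<in> uminus ` (K_set n \<epsilon> \<inter> {0..})"
    by (simp add: K_uminus)
qed

lemma E_F_compact: "compact (E l) \<and> compact (F l)"
proof (induction l)
  case 0
  have E: "compact (E 0)"
    unfolding E_set.simps S1_set_def
    by (rule compact_continuous_image[OF _ compact_Icc]) (intro continuous_intros)
  have "compact (F 0)"
    unfolding F_set.simps[of n \<epsilon> 0]
    by (rule compact_continuous_image[OF _ E]) (intro continuous_intros)
  with E show ?case ..
next
  case (Suc l)
  have E: "compact (E (Suc l))"
    unfolding E_set.simps
    by (rule compact_continuous_image[OF _ Suc.IH[THEN conjunct2]]) (intro continuous_intros)
  have "compact (F (Suc l))"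
    unfolding F_set.simps[of n \<epsilon> "Suc l"]
    by (rule compact_continuous_image[OF _ E]) (intro continuous_intros)
  with E show ?case ..
qed

lemma K_borel: "K_set n \<epsilon> \<in> sets borel"
proof -
  have [measurable]: "E l \<in> sets borel" "F l \<in> sets borel" for l
    using E_F_compact[of l] by (simp_all add: borel_compact)
  have [measurable]: "pos_part \<in> sets borel"
    unfolding pos_part_def R2_ivl_def S1_set_def S2_set_def S3_set_def by measurable
  have "K_set n \<epsilon> = {x. x \<in> pos_part \<or> - x \<in> pos_part}"
    unfolding set_eq_iff mem_Collect_eq by (intro allI K_iff)
  also have "\<dots> \<in> sets borel" by measurable
  finally show ?thesis .
qed

text \<open>Each \<open>F_l\<close> is a nonempty set of positive numbers below \<open>2\<^sup>-\<^sup>l\<close>.\<close>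
lemma islimpt_K: "0 islimpt K_set n \<epsilon>"
  unfolding islimpt_approachable
proof (intro allI impI)
  fix r :: real assume r: "r > 0"
  have "\<exists>x. x \<in> E l" for l
  proof (induction l)
    case 0
    have "a / 2 + \<epsilon> / (4 * N) \<le> a / 2 + \<epsilon>"
      using N_ge_1 \<epsilon>_pos by (simp add: field_simps)
    then have "(a / 2 + \<epsilon> + N) - N \<in> S1" unfolding S1_eq by simp
    then show ?case using E_0_iff by blast
  next
    case (Suc l)
    then obtain x where "x \<in> E l" by blast
    then have "(x / 2 ^ (n + l + 1) + N) - N \<in> F l" by (simp add: F_iff)
    then show ?case using E_Suc_iff by blast
  qed
  then have F: "\<exists>x. x \<in> F l" for l using E_Suc_iff by blast
  obtain l where l: "(1 / 2) ^ l < r" using r real_arch_pow_inv[of r "1 / 2"] by auto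
  obtain x where x: "x \<in> F l" using F by blast
  have "a / 2 / 2 ^ l \<le> 1 / 2 ^ l" using a_bounds by (intro divide_right_mono) auto
  then have "x < r" using F_bounds[OF x] l by (simp add: power_one_over)
  moreover have "x > 0" using F_pos[OF x] by simp
  moreover have "x \<in> K_set n \<epsilon>" using x by (auto simp: K_iff pos_part_iff)
  ultimately show "\<exists>x\<in>K_set n \<epsilon>. x \<noteq> 0 \<and> dist x 0 < r" by (auto intro!: bexI[of _ x])
qed

section \<open>The two tilings\<close>
text \<open>A countable set containing all end points that occur and closed under the affine maps with
  rational coefficients; away from it strict and non-strict inequalities need not be distinguished.\<close>
definition exceptional :: "real set" where
  "exceptional = {of_rat q + of_rat r * \<epsilon> | q r. True}"

lemma exceptional_null: "AE x in lborel. x \<notin> exceptional"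
proof (rule AE_not_in)
  have "exceptional = range (\<lambda>(q, r). of_rat q + of_rat r * \<epsilon>)"
    unfolding exceptional_def by auto
  then have "countable exceptional" by simp
  then show "exceptional \<in> null_sets lborel" by (rule countable_imp_null_set_lborel)
qed

lemma exceptional_affine:
  assumes "x \<in> exceptional" "p \<in> \<rat>" "q \<in> \<rat>"
  shows "p * x + q \<in> exceptional"
proof -
  obtain u v where x: "x = of_rat u + of_rat v * \<epsilon>" using assms(1) unfolding exceptional_def by auto
  obtain p' q' where pq: "p = of_rat p'" "q = of_rat q'" using assms by (auto elim!: Rats_cases)
  have "p * x + q = of_rat (p' * u + q') + of_rat (p' * v) * \<epsilon>"
    unfolding x pq by (simp add: of_rat_add of_rat_mult algebra_simps)
  then show ?thesis unfolding exceptional_def by blast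
qed

lemma exceptionalI:
  assumes "p \<in> \<rat>" "q \<in> \<rat>" shows "p + q * \<epsilon> \<in> exceptional"
  using assms unfolding exceptional_def by (auto elim!: Rats_cases)

lemma not_exceptional_scale: "z \<notin> exceptional \<Longrightarrow> 2 powi j * z \<notin> exceptional"
proof
  assume z: "z \<notin> exceptional" and "2 powi j * z \<in> exceptional"
  then have "2 powi (- j) * (2 powi j * z) + 0 \<in> exceptional"
    by (intro exceptional_affine) (auto simp: power_int_def)
  moreover have "2 powi (- j) * (2 powi j * z) + 0 = z"
    by (simp add: power_int_minus field_simps)
  ultimately show False using z by metis
qed

lemma not_exceptional_shift: "z \<notin> exceptional \<Longrightarrow> z + of_int m \<notin> exceptional"
  using exceptional_affine[of "z + of_int m" 1 "- of_int m"] by auto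

lemma not_exceptional_minus: "z \<notin> exceptional \<Longrightarrow> - z \<notin> exceptional"
  using exceptional_affine[of "- z" "-1" 0] by auto

lemma endpoints_rational: "N \<in> \<rat>" "a \<in> \<rat>" "d \<in> \<rat>"
proof -
  show N: "N \<in> \<rat>" by (simp add: N_def)
  then show "a \<in> \<rat>" unfolding a_eq by (intro Rats_divide Rats_diff Rats_mult) auto
  then show "d \<in> \<rat>" unfolding d_eq(1) using N by (rule Rats_add[rotated])
qed

text \<open>A point of \<open>(0, 1/2)\<close> outside the exceptional set represents its class modulo \<open>1\<close> itself
  if it is kept, and through its translate by \<open>N\<close> otherwise.\<close>
definition kept :: "real set" where
  "kept = moved \<union> {a + 2 * \<epsilon><..}"

lemma pos_part_translation:
  assumes z: "z \<notin> exceptional"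
  shows "z \<in> pos_part \<longleftrightarrow> (0 < z \<and> z < 1 / 2 \<and> z \<in> kept) \<or> (0 < z - N \<and> z - N < 1 / 2 \<and> z - N \<notin> kept)"
proof -
  have ne: "z \<noteq> p + q * \<epsilon>" if "p \<in> \<rat>" "q \<in> \<rat>" for p q
    using exceptionalI[OF that] z by auto
  have n1: "z \<noteq> N" "z \<noteq> d" "z \<noteq> 1 / 2" "z \<noteq> a + 2 * \<epsilon>" "z \<noteq> d + 2 * \<epsilon>"
    using ne[of N 0] ne[of d 0] ne[of "1/2" 0] ne[of a 2] ne[of d 2] endpoints_rational by auto
  have "z \<in> pos_part \<longleftrightarrow> (N < z \<and> z < d \<and> z - N \<notin> moved) \<or> z \<in> moved
     \<or> (a + 2 * \<epsilon> < z \<and> z < 1 / 2) \<or> (d < z \<and> z < d + 2 * \<epsilon>)"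
  proof -
    have "(\<forall>l. z \<notin> E l) \<longleftrightarrow> z - N \<notin> moved" "(\<exists>l. z \<in> F l) \<or> z \<in> S1 \<longleftrightarrow> z \<in> moved"
      using E_iff_moved[of z] unfolding moved_def by blast+
    then show ?thesis unfolding pos_part_iff le_less using n1 by blast
  qed
  moreover have "z \<in> kept \<longleftrightarrow> z \<in> moved \<or> a + 2 * \<epsilon> < z"
    "z - N \<in> kept \<longleftrightarrow> z - N \<in> moved \<or> a + 2 * \<epsilon> < z - N"
    by (auto simp: kept_def)
  moreover have "z \<in> moved \<Longrightarrow> 0 < z \<and> z \<le> a" "z - N \<in> moved \<Longrightarrow> 0 < z - N \<and> z - N \<le> a"
    using moved_bounds by blast+
  ultimately show ?thesis
    using d_eq(1) n1(2,5) \<epsilon>_bounds(1) \<epsilon>_pos a_bounds N_ge_1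
    by (cases "z \<in> moved"; cases "z - N \<in> moved"; simp only: simp_thms; argo)
qed

lemma translation_tiling_pos:
  assumes y: "y \<notin> exceptional" "0 < y" "y < 1 / 2"
  shows "\<exists>!m::int. y + of_int m \<in> K_set n \<epsilon>"
proof -
  define M :: int where "M = 2 ^ (n - 2)"
  have M: "of_int M = N" by (simp add: M_def N_def)
  have *: "y + of_int m \<in> K_set n \<epsilon> \<longleftrightarrow> m = (if y \<in> kept then 0 else M)" for m :: int
  proof -
    have e: "y + of_int m \<notin> exceptional" by (rule not_exceptional_shift[OF y(1)])
    have int_0: "k = 0" if "- 1 < real_of_int k" "real_of_int k < 1" for k :: int
      using that by linarith
    have small: "0 < y + of_int k \<and> y + of_int k < 1 / 2 \<longleftrightarrow> k = 0" for k :: int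
    proof
      assume "0 < y + of_int k \<and> y + of_int k < 1 / 2"
      with y show "k = 0" by (intro int_0) linarith+
    qed (use y in simp)
    have small': "\<not> (0 < - y + of_int k \<and> - y + of_int k < 1 / 2)" for k :: int
    proof
      assume k: "0 < - y + of_int k \<and> - y + of_int k < 1 / 2"
      with y have "k = 0" by (intro int_0) linarith+
      with k y show False by simp
    qed
    have "y + of_int m \<in> pos_part \<longleftrightarrow> m = 0 \<and> y \<in> kept \<or> m - M = 0 \<and> y \<notin> kept"
    proof -
      have "y + of_int m - N = y + of_int (m - M)" by (simp add: M[symmetric])
      then show ?thesis
        unfolding pos_part_translation[OF e] using small[of m] small[of "m - M"] by fastforce
    qed
    then have "y + of_int m \<in> pos_part \<longleftrightarrow> m = (if y \<in> kept then 0 else M)" by auto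
    moreover have "- (y + of_int m) \<notin> pos_part"
    proof -
      have "- (y + of_int m) = - y + of_int (- m)" "- (y + of_int m) - N = - y + of_int (- m - M)"
        by (simp_all add: M[symmetric])
      then show ?thesis
        unfolding pos_part_translation[OF not_exceptional_minus[OF e]]
        using small'[of "- m"] small'[of "- m - M"] by metis
    qed
    ultimately show ?thesis by (simp add: K_iff)
  qed
  then show ?thesis by auto
qed

text \<open>Reduction to \<open>(-1/2, 1/2)\<close> by rounding, and to positive numbers by symmetry.\<close>
lemma translation_tiling:
  assumes x: "x \<notin> exceptional"
  shows "\<exists>!m::int. x + of_int m \<in> K_set n \<epsilon>"
proof -
  define y where "y = x - of_int (round x)"
  have y: "y \<notin> exceptional"
    using not_exceptional_shift[OF x, of "- round x"] by (simp add: y_def)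
  have "0 \<in> exceptional" "1 / 2 \<in> exceptional" "- (1 / 2) \<in> exceptional"
    using exceptionalI[of 0 0] exceptionalI[of "1/2" 0] exceptionalI[of "-(1/2)" 0] by auto
  then have "y \<noteq> 0" "y \<noteq> 1 / 2" "y \<noteq> - (1 / 2)" using y by metis+
  moreover have "\<bar>y\<bar> \<le> 1 / 2"
    using of_int_round_abs_le[of x] by (simp add: y_def abs_minus_commute)
  ultimately have range: "0 < y \<and> y < 1 / 2 \<or> 0 < - y \<and> - y < 1 / 2"
    by (cases "y > 0") linarith+
  have "\<exists>!m::int. y + of_int m \<in> K_set n \<epsilon>"
    using range
  proof
    assume "0 < y \<and> y < 1 / 2"
    then show ?thesis using translation_tiling_pos y by blast
  next
    assume "0 < - y \<and> - y < 1 / 2"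
    then obtain m :: int where m: "\<And>k. - y + of_int k \<in> K_set n \<epsilon> \<longleftrightarrow> k = m"
      using translation_tiling_pos[OF not_exceptional_minus[OF y]] by metis
    have "y + of_int k \<in> K_set n \<epsilon> \<longleftrightarrow> k = - m" for k
      using m[of "- k"] K_uminus[of "y + of_int k"] by (simp add: algebra_simps) linarith
    then show ?thesis by auto
  qed
  then obtain m :: int where m: "\<And>k. y + of_int k \<in> K_set n \<epsilon> \<longleftrightarrow> k = m" by metis
  have "x + of_int k \<in> K_set n \<epsilon> \<longleftrightarrow> k = m - round x" for k
    using m[of "k + round x"] by (auto simp: y_def algebra_simps)
  then show ?thesis by auto
qed

text \<open>The fundamental octave \<open>(d/2, d)\<close> is cut into the pieces \<open>S_3/2\<close>, \<open>2\<^sup>n S_1\<close>, \<open>2\<^sup>n\<^sup>-\<^sup>1 S_2\<close>, the rest of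
  \<open>[N, d]\<close>, and the \<open>E_l\<close>, which are dilates of the \<open>F_l\<close>. The index \<open>i\<close> records the power of
  two by which a piece of the set is multiplied to land at \<open>w\<close>.\<close>
definition reached_by :: "int \<Rightarrow> real \<Rightarrow> bool" where
  "reached_by i w \<longleftrightarrow>
     i = -1 \<and> d / 2 < w \<and> w < d / 2 + \<epsilon>
   \<or> i = int n \<and> d / 2 + \<epsilon> < w \<and> w < d / 2 + 4 * N * \<epsilon>
   \<or> i = int n - 1 \<and> d / 2 + 4 * N * \<epsilon> < w \<and> w < N
   \<or> i = 0 \<and> N < w \<and> w < d \<and> (\<forall>l. w \<notin> E l)
   \<or> (\<exists>l. i = int (n + l + 1) \<and> w \<in> E l)"

lemma octave_order: "0 < d / 2" "\<epsilon> < 4 * N * \<epsilon>" "d / 2 + 4 * N * \<epsilon> < N" "N < d"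
proof -
  show "0 < d / 2" "N < d" using d_eq(1) a_bounds N_ge_1 by auto
  show "\<epsilon> < 4 * N * \<epsilon>" using N_ge_1 \<epsilon>_pos by simp
  have "2 * N * (a + 2 * \<epsilon>) < 2 * N * (1 / 2)"
    using N_ge_1 \<epsilon>_bounds(1) by (intro mult_strict_left_mono) auto
  then show "d / 2 + 4 * N * \<epsilon> < N" unfolding d_eq(2) by (simp add: algebra_simps)
qed

lemma reached_once:
  assumes w: "w \<notin> exceptional" "d / 2 < w" "w < d"
  shows "\<exists>!i. reached_by i w"
proof -
  have ne: "w \<noteq> p + q * \<epsilon>" if "p \<in> \<rat>" "q \<in> \<rat>" for p q
    using exceptionalI[OF that] w by auto
  have n1: "w \<noteq> N" "w \<noteq> d / 2 + \<epsilon>" "w \<noteq> d / 2 + 4 * N * \<epsilon>"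
    using ne[of N 0] ne[of "d / 2" 1] ne[of "d / 2" "4 * N"] endpoints_rational by auto
  \<comment> \<open>The product is named so that arithmetic sees linear constraints only.\<close>
  define D where "D = 4 * N * \<epsilon>"
  note ord = octave_order[folded D_def]
  note reached = reached_by_def[of _ w, folded D_def]
  have E: "N < w" if "w \<in> E l" for l using E_bounds[OF that] n1 by simp
  consider "w < d / 2 + \<epsilon>" | "d / 2 + \<epsilon> < w" "w < d / 2 + D"
    | "d / 2 + D < w" "w < N" | "N < w" "\<forall>l. w \<notin> E l" | l where "N < w" "w \<in> E l"
    using n1[folded D_def] by force
  then have "\<exists>i0. \<forall>i. reached_by i w \<longleftrightarrow> i = i0"
  proof cases
    case 1
    have no_E: "w \<notin> E l" for l using E[of l] 1 ord by linarith
    have "\<not> d / 2 + \<epsilon> < w" "\<not> d / 2 + D < w" "\<not> N < w" using 1 ord by linarith+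
    then have "reached_by i w \<longleftrightarrow> i = -1" for i unfolding reached using 1 w(2) no_E by blast
    then show ?thesis by blast
  next
    case 2
    have no_E: "w \<notin> E l" for l using E[of l] 2 ord by linarith
    have "\<not> w < d / 2 + \<epsilon>" "\<not> d / 2 + D < w" "\<not> N < w" using 2 ord by linarith+
    then have "reached_by i w \<longleftrightarrow> i = int n" for i unfolding reached using 2 no_E by blast
    then show ?thesis by blast
  next
    case 3
    have no_E: "w \<notin> E l" for l using E[of l] 3 by linarith
    have "\<not> w < d / 2 + \<epsilon>" "\<not> w < d / 2 + D" "\<not> N < w" using 3 ord by linarith+
    then have "reached_by i w \<longleftrightarrow> i = int n - 1" for i unfolding reached using 3 no_E by blast
    then show ?thesis by blast
  next
    case 4
    have "\<not> w < d / 2 + \<epsilon>" "\<not> w < d / 2 + D" "\<not> w < N" using 4 ord by linarith+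
    then have "reached_by i w \<longleftrightarrow> i = 0" for i unfolding reached using 4 w(3) by blast
    then show ?thesis by blast
  next
    case (5 l)
    have only_l: "w \<in> E m \<longleftrightarrow> m = l" for m using E_inj[OF _ 5(2)] 5(2) by blast
    have "\<not> w < d / 2 + \<epsilon>" "\<not> w < d / 2 + D" "\<not> w < N" using 5(1) ord by linarith+
    then have "reached_by i w \<longleftrightarrow> i = int (n + l + 1)" for i unfolding reached only_l by blast
    then show ?thesis by blast
  qed
  then show ?thesis by auto
qed

lemma reached_range:
  assumes "reached_by i w" "w \<notin> exceptional"
  shows "d / 2 < w \<and> w < d"
proof -
  have ne: "w \<noteq> d" using exceptionalI[of d 0] endpoints_rational assms(2) by auto
  consider "d / 2 < w" "w < d / 2 + \<epsilon>" | "d / 2 + \<epsilon> < w" "w < d / 2 + 4 * N * \<epsilon>"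
    | "d / 2 + 4 * N * \<epsilon> < w" "w < N" | "N \<le> w" "w \<le> d"
    using assms(1) E_bounds unfolding reached_by_def by (blast intro: less_imp_le)
  then show ?thesis using ne octave_order \<epsilon>_pos by cases linarith+
qed

lemma pos_part_dilation:
  assumes z: "z \<notin> exceptional"
  shows "z \<in> pos_part \<longleftrightarrow> (\<exists>i. reached_by i (2 powi i * z))"
proof -
  have ne: "z \<noteq> p + q * \<epsilon>" if "p \<in> \<rat>" "q \<in> \<rat>" for p q
    using exceptionalI[OF that] z by auto
  have n1: "z \<noteq> N" "z \<noteq> d" "z \<noteq> 1 / 2" "z \<noteq> a + 2 * \<epsilon>" "z \<noteq> d + 2 * \<epsilon>"
      "z \<noteq> a / 2 + \<epsilon>" "z \<noteq> a / 2 + \<epsilon> / (4 * N)"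
    using ne[of N 0] ne[of d 0] ne[of "1/2" 0] ne[of a 2] ne[of d 2] ne[of "a / 2" 1]
      ne[of "a / 2" "1 / (4 * N)"] endpoints_rational by auto
  have pw: "2 powi int n = 4 * N" "2 powi (int n - 1) = 2 * N"
    using n two_power_n two_power_n_minus_1 by (simp_all add: of_nat_diff flip: power_int_of_nat)
  have "z \<in> S1 \<longleftrightarrow> d / 2 + \<epsilon> < 2 powi int n * z \<and> 2 powi int n * z < d / 2 + 4 * N * \<epsilon>"
  proof -
    have "d / 2 + \<epsilon> = 4 * N * (a / 2 + \<epsilon> / (4 * N))" "d / 2 + 4 * N * \<epsilon> = 4 * N * (a / 2 + \<epsilon>)"
      unfolding d_eq(2) using N_ge_1 by (simp_all add: field_simps)
    then have "d / 2 + \<epsilon> < 4 * N * z \<longleftrightarrow> a / 2 + \<epsilon> / (4 * N) < z"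
      "4 * N * z < d / 2 + 4 * N * \<epsilon> \<longleftrightarrow> z < a / 2 + \<epsilon>"
      using mult_less_cancel_left_pos[of "4 * N" "a / 2 + \<epsilon> / (4 * N)" z]
        mult_less_cancel_left_pos[of "4 * N" z "a / 2 + \<epsilon>"] N_ge_1 by simp_all
    then show ?thesis unfolding S1_eq pw atLeastAtMost_iff le_less using n1(6,7) by blast
  qed
  moreover have "a + 2 * \<epsilon> \<le> z \<and> z \<le> 1 / 2
      \<longleftrightarrow> d / 2 + 4 * N * \<epsilon> < 2 powi (int n - 1) * z \<and> 2 powi (int n - 1) * z < N"
  proof -
    have "d / 2 + 4 * N * \<epsilon> = 2 * N * (a + 2 * \<epsilon>)" "N = 2 * N * (1 / 2)"
      unfolding d_eq(2) by (simp_all add: algebra_simps)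
    then have "d / 2 + 4 * N * \<epsilon> < 2 * N * z \<longleftrightarrow> a + 2 * \<epsilon> < z" "2 * N * z < N \<longleftrightarrow> z < 1 / 2"
      using mult_less_cancel_left_pos[of "2 * N" "a + 2 * \<epsilon>" z] mult_less_cancel_left_pos[of "2 * N" z "1 / 2"]
        N_ge_1 by simp_all
    then show ?thesis unfolding pw using n1 by auto
  qed
  moreover have "d \<le> z \<and> z \<le> d + 2 * \<epsilon> \<longleftrightarrow> d / 2 < 2 powi (-1) * z \<and> 2 powi (-1) * z < d / 2 + \<epsilon>"
    using n1 by (auto simp: power_int_minus)
  moreover have "N \<le> z \<and> z \<le> d \<and> (\<forall>l. z \<notin> E l) \<longleftrightarrow> N < 2 powi 0 * z \<and> 2 powi 0 * z < d \<and> (\<forall>l. 2 powi 0 * z \<notin> E l)"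
    using n1 by auto
  moreover have "z \<in> F l \<longleftrightarrow> 2 powi (int (n + l + 1)) * z \<in> E l" for l
    by (simp only: F_iff power_int_of_nat)
  moreover have "(\<exists>i l. i = f l \<and> P i l) \<longleftrightarrow> (\<exists>l. P (f l) l)" for f :: "nat \<Rightarrow> int" and P
    by blast
  ultimately show ?thesis
    unfolding pos_part_iff reached_by_def by (simp only: ex_disj_distrib simp_thms disj_ac)
qed

text \<open>If \<open>2\<^sup>k z\<close> is the dilate of \<open>z\<close> in the fundamental octave and \<open>i\<close> is the one index by which it is
  reached, then \<open>j = k - i\<close> is the only exponent that brings \<open>z\<close> into the set.\<close>
lemma dilation_tiling_pos:
  assumes z: "z \<notin> exceptional" "z > 0"
  shows "\<exists>!j::int. 2 powi j * z \<in> pos_part"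
proof -
  have w: "2 powi j * z \<notin> exceptional" for j by (rule not_exceptional_scale[OF z(1)])
  have d_ne: "2 powi j * z \<noteq> d" for j
    using w[of j] exceptionalI[of d 0] endpoints_rational by auto
  obtain k :: int where k: "d / 2 < 2 powi k * z" "2 powi k * z \<le> 2 * (d / 2)"
    using octave_exists[OF octave_order(1) z(2)] by blast
  then have k': "2 powi k * z < 2 * (d / 2)" using d_ne[of k] by simp
  obtain i where i: "\<And>i'. reached_by i' (2 powi k * z) \<longleftrightarrow> i' = i"
    using reached_once[OF w k(1)] k' by auto
  have "2 powi j * z \<in> pos_part \<longleftrightarrow> j = k - i" for j
  proof -
    have comp: "2 powi i' * (2 powi j * z) = 2 powi (i' + j) * z" for i'
      by (simp add: power_int_add)
    have "2 powi j * z \<in> pos_part \<longleftrightarrow> (\<exists>i'. reached_by i' (2 powi (i' + j) * z))"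
      unfolding pos_part_dilation[OF w] comp ..
    also have "\<dots> \<longleftrightarrow> (\<exists>i'. i' + j = k \<and> reached_by i' (2 powi k * z))"
    proof -
      have "i' + j = k" if "reached_by i' (2 powi (i' + j) * z)" for i'
        using reached_range[OF that w] k(1) k' octave_order(1)
        by (intro same_octave[of "d / 2" _ z]) auto
      then show ?thesis by metis
    qed
    also have "\<dots> \<longleftrightarrow> j = k - i" unfolding i by auto
    finally show ?thesis .
  qed
  then show ?thesis by auto
qed

lemma dilation_tiling:
  assumes z: "z \<notin> exceptional"
  shows "\<exists>!j::int. 2 powi j * z \<in> K_set n \<epsilon>"
proof -
  have "z \<noteq> 0" using z exceptionalI[of 0 0] by auto
  have pos: "\<exists>!j::int. 2 powi j * z \<in> K_set n \<epsilon>" if z: "z \<notin> exceptional" "z > 0" for z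
  proof -
    have "2 powi j * z \<in> K_set n \<epsilon> \<longleftrightarrow> 2 powi j * z \<in> pos_part" for j :: int
    proof -
      have "2 powi j * z > 0" using z by simp
      then have "- (2 powi j * z) \<notin> pos_part" using pos_part_bounds[of "- (2 powi j * z)"] by auto
      then show ?thesis by (simp add: K_iff)
    qed
    then show ?thesis using dilation_tiling_pos[OF z] by simp
  qed
  show ?thesis
  proof (cases "z > 0")
    case True
    then show ?thesis using pos z by blast
  next
    case False
    then have "\<exists>!j::int. 2 powi j * (- z) \<in> K_set n \<epsilon>"
      using pos[of "- z"] not_exceptional_minus[OF z] \<open>z \<noteq> 0\<close> by simp
    then show ?thesis by (simp add: K_uminus)
  qed
qed

sublocale wavelet_tiling "K_set n \<epsilon>"
proof
  show "AE x in lborel. \<exists>!m::int. x + of_int m \<in> K_set n \<epsilon>"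
    using exceptional_null by eventually_elim (rule translation_tiling)
  show "AE x in lborel. \<exists>!j::int. 2 powi j * x \<in> K_set n \<epsilon>"
    using exceptional_null by eventually_elim (rule dilation_tiling)
qed (rule K_borel bounded_K)+

end

theorem theorem21:
  fixes n :: nat and \<epsilon> :: real
  assumes "n \<ge> 2" and "0 < \<epsilon>" and "\<epsilon> < e_par n / 4"
  shows "bounded (K_set n \<epsilon>) \<and> symmetric_set (K_set n \<epsilon>) \<and> wavelet_set (K_set n \<epsilon>)
    \<and> 0 islimpt K_set n \<epsilon>"
proof -
  interpret parameters n \<epsilon> using assms by unfold_locales
  show ?thesis using bounded_K symmetric_K wavelet_set islimpt_K by blast
qed

end
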